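(* Let $(Y^N_n)_{n=0}^{N}$, $(Z^N_n)_{n=0}^{N-1}$ be defined by the backward Euler scheme: $Y^N_N=\partial_xg(X_N,\mu_N)+\widehat{\mathbb E}[D_\mu g(\widehat X_N,\mu_N)(X_N)]$ and, for $n=N-1,\dots,0$, $$Z^N_n=\frac1{\Delta t}\mathbb E_{t_n}\big[Y^N_{n+1}(\Delta W_n)^\top\big],$$ $$Y^N_n=\mathbb E_{t_n}\big[Y^N_{n+1}+\partial_xH(t_n,X_n,\mu_n,Y^N_{n+1},Z^N_n,u_n)\Delta t\big]+\widehat{\mathbb E}\big[D_\mu\widehat b_n(X_n)^\top\widehat Y^N_{n+1}+D_\mu\widehat f_n(X_n)\big]\Delta t .$$ Let $(\bar Y_n)_{n=0}^{N}$, $(\bar Z_n)_{n=0}^{N-1}$ be defined by the sample-wise recursion: $\bar Y_N=\partial_xg(X_N,\mu_N)+\widehat{\mathbb E}[D_\mu g(\widehat X_N,\mu_N)(X_N)]$ and, for $n=N-1,\dots,0$, $$\bar Z_n=\frac{\bar Y_{n+1}(\Delta W_n)^\top}{\Delta t},$$ $$\bar Y_n=\bar Y_{n+1}+\partial_xH(t_n,X_n,\mu_n,\bar Y_{n+1},\bar Z_n,u_n)\Delta t+\widehat{\mathbb E}\big[D_\mu\widehat b_n(X_n)^\top\widehat{\bar Y}_{n+1}+D_\mu\widehat f_n(X_n)\big]\Delta t .$$ Then for every $n=0,\dots,N-1$, $$\mathbb E_{t_n}[\bar Y_n]=Y^N_n,\qquad \mathbb E_{t_n}[\bar Z_n]=Z^N_n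 .$$ Consequently $\mathbb E[\bar Y_n]=\mathbb E[Y^N_n]$ and $\mathbb E[\bar Z_n]=\mathbb E[Z^N_n]$.
   Context: Setting. $\mathcal P_2(\mathbb R^d)$ is the space of probability measures on $\mathbb R^d$ with finite second moment, with Wasserstein distance $W_2$; $D_\mu$ is the Lions derivative: $D_\mu h(\mu)(\cdot):\mathbb R^d\to\mathbb R^d$ is characterized by the Fréchet derivative of the lift $X\mapsto h(\mathcal L_X)$ on $L^2(\Omega;\mathbb R^d)$ being $D_\mu h(\mathcal L_X)(X)$; for vector-valued $h$ it is matrix-valued, row by row. $U\subset\mathbb R^{d_1}$ is the control space. The data are measurable $b:[0,T]\times\mathbb R^d\times\mathcal P_2(\mathbb R^d)\times U\to\mathbb R^d$, $\sigma:[0,T]\times\mathbb R^d\times U\to\mathbb R^{d\times m}$ (the diffusion coefficient does not depend on the law), $f:[0,T]\times\mathbb R^d\times\mathcal P_2(\mathbb R^d)\times U\to\mathbb R$ and $g:\mathbb R^d\times\mathcal P_2(\mathbb R^d)\to\mathbb R$. Standing assumptions. (1) $\int_0^T(|b(t,x,\mu,a)|^2+|\sigma(t,x,a)|^2)dt<\infty$ for all $x,\mu,a$; $b$ and $\sigma$ are Lipschitz in $(x,\mu)$ (with $W_2$ for $\mu$), uniformly in $(t,a)$; $f,g$ have at most quadratic growth: $|f(t,x,\mu,a)|\le C(1+|x|^2+|a|^2+\int|y|^2\mu(dy))$, $|g(x,\mu)|\le C(1+|x|^2+\int|y|^2\mu(dy))$. (2) For every $t$, $b,\sigma,f$ are continuously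 differentiable in $(x,u)$ and Lions differentiable in $\mu$, and $g$ is continuously differentiable in $x$ and Lions differentiable in $\mu$; $\partial_xb,\partial_ub,\partial_x\sigma,\partial_u\sigma,D_\mu b$ are continuous and uniformly bounded; $\partial_xf,\partial_uf,D_\mu f,\partial_xg,D_\mu g$ are continuous with at most linear growth. Hamiltonian: $H(t,x,\mu,y,z,u)=f(t,x,\mu,u)+b(t,x,\mu,u)^\top y+\mathrm{Tr}(\sigma(t,x,u)^\top z)$. Discretization. $t_n=n\Delta t$, $\Delta t=T/N$, $W$ is an $m$-dimensional Brownian motion with respect to a filtration $(\mathcal F_t)$, $\Delta W_n=W_{t_{n+1}}-W_{t_n}$, $X_0$ is $\mathcal F_0$-measurable with law in $\mathcal P_2(\mathbb R^d)$ and independent of $W$. The state follows the Euler scheme $X_{n+1}=X_n+b(t_n,X_n,\mu_n,u_n)\Delta t+\sigma(t_n,X_n,u_n)\Delta W_n$ with $\mu_n=\mathcal L_{X_n}$ and feedback control $u_n=\phi(t_n,X_n,\mu_n)$ for a deterministic measurable $\phi:[0,T]\times\mathbb R^d\times\mathcal P_2(\mathbb R^d)\to U$, the control being admissible: $u_n$, $b(t_n,0,\delta_0,u_n)$ and $\sigma(t_n,0,u_n)$ are square-integrable. $\mathbb E_{t_n}[\cdot]=\mathbb E[\cdot\mid\mathcal F_{t_n}]$. Hatted quantities $\widehat X_n,\widehat u_n,\widehat Y^N_n,\widehat{\bar Y}_n$ are (jointly) independent copies of the corresponding unhatted ones, and $\widehat{\mathbb E}$ is expectation over the copy only. $D_\mu\widehat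 b_n(X_n):=D_\mu b(t_n,\widehat X_n,\mu_n,\widehat u_n)(X_n)$, $D_\mu\widehat f_n(X_n):=D_\mu f(t_n,\widehat X_n,\mu_n,\widehat u_n)(X_n)$. *)

theory Defs
  imports "HOL-Probability.Probability"
begin

section \<open>The Wasserstein space\<close>

definition P2 :: "'v::euclidean_space measure set" where
  "P2 = {\<mu>. prob_space \<mu> \<and> sets \<mu> = sets borel \<and> integrable \<mu> (\<lambda>x. (norm x)\<^sup>2)}"

definition second_moment :: "'v::euclidean_space measure \<Rightarrow> real" where
  "second_moment \<mu> = (\<integral>x. (norm x)\<^sup>2 \<partial>\<mu>)"

definition couplings :: "'v::euclidean_space measure \<Rightarrow> 'v measure \<Rightarrow> ('v \<times> 'v) measure set" where
  "couplings \<mu> \<nu> = {\<pi>. prob_space \<pi> \<and> sets \<pi> = sets borel \<and>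
     distr \<pi> borel fst = \<mu> \<and> distr \<pi> borel snd = \<nu>}"

text \<open>Meaningful on \<^const>\<open>P2\<close> only, where the infimum is over a nonempty set of finite,
  nonnegative numbers.\<close>

definition W2 :: "'v::euclidean_space measure \<Rightarrow> 'v measure \<Rightarrow> real" where
  "W2 \<mu> \<nu> = sqrt (INF \<pi>\<in>couplings \<mu> \<nu>. \<integral>z. (dist (fst z) (snd z))\<^sup>2 \<partial>\<pi>)"

definition W2_open :: "'v::euclidean_space measure set \<Rightarrow> bool" where
  "W2_open S \<longleftrightarrow> S \<subseteq> P2 \<and> (\<forall>\<mu>\<in>S. \<exists>e>0. \<forall>\<nu>\<in>P2. W2 \<mu> \<nu> < e \<longrightarrow> \<nu> \<in> S)"

definition W2_topology :: "'v::euclidean_space measure topology" where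
  "W2_topology = topology W2_open"

lemma openin_W2_topology:
  fixes S :: "'v::euclidean_space measure set"
  shows "openin W2_topology S \<longleftrightarrow> W2_open S"
proof -
  have "istopology (W2_open :: 'v measure set \<Rightarrow> bool)"
    unfolding istopology_def
  proof (intro conjI allI impI)
    fix S S' :: "'v measure set"
    assume S: "W2_open S" and S': "W2_open S'"
    show "W2_open (S \<inter> S')"
      unfolding W2_open_def
    proof (intro conjI ballI)
      show "S \<inter> S' \<subseteq> P2" using S by (auto simp: W2_open_def)
      fix \<mu> assume \<mu>: "\<mu> \<in> S \<inter> S'"
      obtain e where e: "e > 0" "\<forall>\<nu>\<in>P2. W2 \<mu> \<nu> < e \<longrightarrow> \<nu> \<in> S"
        using S \<mu> unfolding W2_open_def by blast
      obtain e' where e': "e' > 0" "\<forall>\<nu>\<in>P2. W2 \<mu> \<nu> < e' \<longrightarrow> \<nu> \<in> S'"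
        using S' \<mu> unfolding W2_open_def by blast
      show "\<exists>e>0. \<forall>\<nu>\<in>P2. W2 \<mu> \<nu> < e \<longrightarrow> \<nu> \<in> S \<inter> S'"
        using e e' by (intro exI[of _ "min e e'"]) auto
    qed
  next
    fix K :: "'v measure set set"
    assume K: "\<forall>S\<in>K. W2_open S"
    show "W2_open (\<Union> K)"
      unfolding W2_open_def
    proof (intro conjI ballI)
      show "\<Union> K \<subseteq> P2" using K by (auto simp: W2_open_def)
      fix \<mu> assume "\<mu> \<in> \<Union> K"
      then obtain S where "S \<in> K" "\<mu> \<in> S" by blast
      then show "\<exists>e>0. \<forall>\<nu>\<in>P2. W2 \<mu> \<nu> < e \<longrightarrow> \<nu> \<in> \<Union> K"
        using K unfolding W2_open_def by (meson UnionI)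
    qed
  qed
  then show ?thesis
    by (simp add: W2_topology_def topology_inverse')
qed

lemma topspace_W2_topology: "topspace W2_topology = (P2 :: 'v::euclidean_space measure set)"
proof
  show "topspace W2_topology \<subseteq> (P2 :: 'v measure set)"
    using openin_topspace[of "W2_topology :: 'v measure topology"]
    unfolding openin_W2_topology W2_open_def by blast
  have "W2_open (P2 :: 'v measure set)"
    unfolding W2_open_def using zero_less_one by blast
  then show "(P2 :: 'v measure set) \<subseteq> topspace W2_topology"
    by (intro openin_subset) (simp add: openin_W2_topology)
qed

definition P2_borel :: "'v::euclidean_space measure measure" where
  "P2_borel = sigma P2 {S. openin W2_topology S}"


section \<open>Square-integrable random variables and the Lions derivative\<close>

definition L2 :: "'a measure \<Rightarrow> ('a \<Rightarrow> 'v::euclidean_space) set" where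
  "L2 M = {X \<in> borel_measurable M. integrable M (\<lambda>\<omega>. (norm (X \<omega>))\<^sup>2)}"

definition L2_norm :: "'a measure \<Rightarrow> ('a \<Rightarrow> 'v::euclidean_space) \<Rightarrow> real" where
  "L2_norm M X = sqrt (\<integral>\<omega>. (norm (X \<omega>))\<^sup>2 \<partial>M)"

text \<open>The lift of \<open>h\<close> to the square-integrable random variables on \<open>M\<close> is Frechet differentiable
  at every \<open>X\<close>, with derivative (gradient) \<open>D \<L>\<^sub>X (X)\<close>.  As the Lions derivative, this
  is meaningful for an atomless \<open>M\<close>, i.e. one on which every law is the law of some \<open>X\<close>.\<close>

definition has_lions_derivative ::
  "'a measure \<Rightarrow> ('v::euclidean_space measure \<Rightarrow> real) \<Rightarrow> ('v measure \<Rightarrow> 'v \<Rightarrow> 'v) \<Rightarrow> bool" where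
  "has_lions_derivative M h D \<longleftrightarrow>
    (\<forall>X\<in>L2 M. (\<lambda>\<omega>. D (distr M borel X) (X \<omega>)) \<in> L2 M \<and>
      (\<forall>\<epsilon>>0. \<exists>\<delta>>0. \<forall>\<xi>\<in>L2 M. L2_norm M \<xi> < \<delta> \<longrightarrow>
        \<bar>h (distr M borel (\<lambda>\<omega>. X \<omega> + \<xi> \<omega>)) - h (distr M borel X)
           - (\<integral>\<omega>. D (distr M borel X) (X \<omega>) \<bullet> \<xi> \<omega> \<partial>M)\<bar> \<le> \<epsilon> * L2_norm M \<xi>))"


section \<open>Derivatives and the Hamiltonian\<close>

definition grad :: "('v::euclidean_space \<Rightarrow> real) \<Rightarrow> 'v \<Rightarrow> 'v" where
  "grad h x = (THE D. GDERIV h x :> D)"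

text \<open>Continuous differentiability in \<open>(x, u)\<close>, with partial derivatives continuous in
  \<open>(x, \<mu>, u)\<close>.  Since \<open>U\<close> is an arbitrary set, derivatives are taken within it.\<close>

definition C1_in_xu ::
  "(real^'c) set \<Rightarrow> (real^'d \<Rightarrow> (real^'d) measure \<Rightarrow> real^'c \<Rightarrow> 'e::real_normed_vector) \<Rightarrow>
   (real^'d \<Rightarrow> (real^'d) measure \<Rightarrow> real^'c \<Rightarrow> (real^'d) \<Rightarrow>\<^sub>L 'e) \<Rightarrow>
   (real^'d \<Rightarrow> (real^'d) measure \<Rightarrow> real^'c \<Rightarrow> (real^'c) \<Rightarrow>\<^sub>L 'e) \<Rightarrow> bool" where
  "C1_in_xu U h Dx Du \<longleftrightarrow>
    (\<forall>x. \<forall>\<mu>\<in>P2. \<forall>u\<in>U. ((\<lambda>(x', u'). h x' \<mu> u') has_derivative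
        (\<lambda>(\<xi>, \<eta>). blinfun_apply (Dx x \<mu> u) \<xi> + blinfun_apply (Du x \<mu> u) \<eta>))
      (at (x, u) within UNIV \<times> U)) \<and>
    continuous_map (prod_topology euclidean (prod_topology W2_topology (top_of_set U))) euclidean
      (\<lambda>(x, \<mu>, u). Dx x \<mu> u) \<and>
    continuous_map (prod_topology euclidean (prod_topology W2_topology (top_of_set U))) euclidean
      (\<lambda>(x, \<mu>, u). Du x \<mu> u)"

definition hamiltonian ::
  "(real \<Rightarrow> real^'d \<Rightarrow> (real^'d) measure \<Rightarrow> real^'c \<Rightarrow> real^'d) \<Rightarrow>
   (real \<Rightarrow> real^'d \<Rightarrow> real^'c \<Rightarrow> real^'m^'d) \<Rightarrow>
   (real \<Rightarrow> real^'d \<Rightarrow> (real^'d) measure \<Rightarrow> real^'c \<Rightarrow> real) \<Rightarrow>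
   real \<Rightarrow> real^'d \<Rightarrow> (real^'d) measure \<Rightarrow> real^'d \<Rightarrow> real^'m^'d \<Rightarrow> real^'c \<Rightarrow> real" where
  "hamiltonian b \<sigma> f t x \<mu> y z u =
     f t x \<mu> u + b t x \<mu> u \<bullet> y + trace (transpose (\<sigma> t x u) ** z)"

definition grad_x_hamiltonian ::
  "(real \<Rightarrow> real^'d \<Rightarrow> (real^'d) measure \<Rightarrow> real^'c \<Rightarrow> real^'d) \<Rightarrow>
   (real \<Rightarrow> real^'d \<Rightarrow> real^'c \<Rightarrow> real^'m^'d) \<Rightarrow>
   (real \<Rightarrow> real^'d \<Rightarrow> (real^'d) measure \<Rightarrow> real^'c \<Rightarrow> real) \<Rightarrow>
   real \<Rightarrow> real^'d \<Rightarrow> (real^'d) measure \<Rightarrow> real^'d \<Rightarrow> real^'m^'d \<Rightarrow> real^'c \<Rightarrow> real^'d" where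
  "grad_x_hamiltonian b \<sigma> f t x \<mu> y z u = grad (\<lambda>x'. hamiltonian b \<sigma> f t x' \<mu> y z u) x"


section \<open>Standing assumptions\<close>

definition measurable_data ::
  "real \<Rightarrow> (real^'c) set \<Rightarrow>
   (real \<Rightarrow> real^'d \<Rightarrow> (real^'d) measure \<Rightarrow> real^'c \<Rightarrow> real^'d) \<Rightarrow>
   (real \<Rightarrow> real^'d \<Rightarrow> real^'c \<Rightarrow> real^'m^'d) \<Rightarrow>
   (real \<Rightarrow> real^'d \<Rightarrow> (real^'d) measure \<Rightarrow> real^'c \<Rightarrow> real) \<Rightarrow>
   (real^'d \<Rightarrow> (real^'d) measure \<Rightarrow> real) \<Rightarrow> bool" where
  "measurable_data T U b \<sigma> f g \<longleftrightarrow>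
    (\<lambda>(t, x, \<mu>, u). b t x \<mu> u) \<in> borel_measurable
      (restrict_space borel {0..T} \<Otimes>\<^sub>M borel \<Otimes>\<^sub>M P2_borel \<Otimes>\<^sub>M restrict_space borel U) \<and>
    (\<lambda>(t, x, u). \<sigma> t x u) \<in> borel_measurable
      (restrict_space borel {0..T} \<Otimes>\<^sub>M borel \<Otimes>\<^sub>M restrict_space borel U) \<and>
    (\<lambda>(t, x, \<mu>, u). f t x \<mu> u) \<in> borel_measurable
      (restrict_space borel {0..T} \<Otimes>\<^sub>M borel \<Otimes>\<^sub>M P2_borel \<Otimes>\<^sub>M restrict_space borel U) \<and>
    (\<lambda>(x, \<mu>). g x \<mu>) \<in> borel_measurable (borel \<Otimes>\<^sub>M P2_borel)"

definition lipschitz_growth_assumption ::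
  "real \<Rightarrow> (real^'c) set \<Rightarrow>
   (real \<Rightarrow> real^'d \<Rightarrow> (real^'d) measure \<Rightarrow> real^'c \<Rightarrow> real^'d) \<Rightarrow>
   (real \<Rightarrow> real^'d \<Rightarrow> real^'c \<Rightarrow> real^'m^'d) \<Rightarrow>
   (real \<Rightarrow> real^'d \<Rightarrow> (real^'d) measure \<Rightarrow> real^'c \<Rightarrow> real) \<Rightarrow>
   (real^'d \<Rightarrow> (real^'d) measure \<Rightarrow> real) \<Rightarrow> bool" where
  "lipschitz_growth_assumption T U b \<sigma> f g \<longleftrightarrow>
    (\<forall>x. \<forall>\<mu>\<in>P2. \<forall>a\<in>U.
       set_integrable lborel {0..T} (\<lambda>t. (norm (b t x \<mu> a))\<^sup>2 + (norm (\<sigma> t x a))\<^sup>2)) \<and>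
    (\<exists>L. \<forall>t\<in>{0..T}. \<forall>a\<in>U. \<forall>x x'. \<forall>\<mu>\<in>P2. \<forall>\<mu>'\<in>P2.
       norm (b t x \<mu> a - b t x' \<mu>' a) \<le> L * (norm (x - x') + W2 \<mu> \<mu>') \<and>
       norm (\<sigma> t x a - \<sigma> t x' a) \<le> L * norm (x - x')) \<and>
    (\<exists>C. \<forall>t\<in>{0..T}. \<forall>x. \<forall>\<mu>\<in>P2. \<forall>a\<in>U.
       \<bar>f t x \<mu> a\<bar> \<le> C * (1 + (norm x)\<^sup>2 + (norm a)\<^sup>2 + second_moment \<mu>)) \<and>
    (\<exists>C. \<forall>x. \<forall>\<mu>\<in>P2. \<bar>g x \<mu>\<bar> \<le> C * (1 + (norm x)\<^sup>2 + second_moment \<mu>))"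

text \<open>\<open>Dmub\<close>, \<open>Dmuf\<close>, \<open>Dmug\<close> are the Lions derivatives in their versions that are jointly
  continuous in all arguments but time (the last argument is the point at which the derivative
  is evaluated); row \<open>i\<close> of \<open>Dmub\<close> is the Lions derivative of the \<open>i\<close>-th component of \<open>b\<close>.\<close>

definition differentiability_assumption ::
  "'a measure \<Rightarrow> real \<Rightarrow> (real^'c) set \<Rightarrow>
   (real \<Rightarrow> real^'d \<Rightarrow> (real^'d) measure \<Rightarrow> real^'c \<Rightarrow> real^'d) \<Rightarrow>
   (real \<Rightarrow> real^'d \<Rightarrow> real^'c \<Rightarrow> real^'m^'d) \<Rightarrow>
   (real \<Rightarrow> real^'d \<Rightarrow> (real^'d) measure \<Rightarrow> real^'c \<Rightarrow> real) \<Rightarrow>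
   (real^'d \<Rightarrow> (real^'d) measure \<Rightarrow> real) \<Rightarrow>
   (real \<Rightarrow> real^'d \<Rightarrow> (real^'d) measure \<Rightarrow> real^'c \<Rightarrow> real^'d \<Rightarrow> real^'d^'d) \<Rightarrow>
   (real \<Rightarrow> real^'d \<Rightarrow> (real^'d) measure \<Rightarrow> real^'c \<Rightarrow> real^'d \<Rightarrow> real^'d) \<Rightarrow>
   (real^'d \<Rightarrow> (real^'d) measure \<Rightarrow> real^'d \<Rightarrow> real^'d) \<Rightarrow> bool" where
  "differentiability_assumption M T U b \<sigma> f g Dmub Dmuf Dmug \<longleftrightarrow>
    (\<exists>Dxb Dub C. \<forall>t\<in>{0..T}.
       C1_in_xu U (b t) (Dxb t) (Dub t) \<and>
       (\<forall>x. \<forall>\<mu>\<in>P2. \<forall>u\<in>U. norm (Dxb t x \<mu> u) \<le> C \<and> norm (Dub t x \<mu> u) \<le> C)) \<and>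
    (\<exists>Dx\<sigma> Du\<sigma> C. \<forall>t\<in>{0..T}.
       C1_in_xu U (\<lambda>x _ u. \<sigma> t x u) (\<lambda>x _ u. Dx\<sigma> t x u) (\<lambda>x _ u. Du\<sigma> t x u) \<and>
       (\<forall>x. \<forall>u\<in>U. norm (Dx\<sigma> t x u) \<le> C \<and> norm (Du\<sigma> t x u) \<le> C)) \<and>
    (\<exists>Dxf Duf C. \<forall>t\<in>{0..T}.
       C1_in_xu U (f t) (Dxf t) (Duf t) \<and>
       (\<forall>x. \<forall>\<mu>\<in>P2. \<forall>u\<in>U.
          norm (Dxf t x \<mu> u) \<le> C * (1 + norm x + norm u + sqrt (second_moment \<mu>)) \<and>
          norm (Duf t x \<mu> u) \<le> C * (1 + norm x + norm u + sqrt (second_moment \<mu>)))) \<and>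
    (\<exists>Dxg C.
       (\<forall>x. \<forall>\<mu>\<in>P2. ((\<lambda>x'. g x' \<mu>) has_derivative blinfun_apply (Dxg x \<mu>)) (at x)) \<and>
       continuous_map (prod_topology euclidean W2_topology) euclidean (\<lambda>(x, \<mu>). Dxg x \<mu>) \<and>
       (\<forall>x. \<forall>\<mu>\<in>P2. norm (Dxg x \<mu>) \<le> C * (1 + norm x + sqrt (second_moment \<mu>)))) \<and>
    (\<forall>t\<in>{0..T}.
       (\<forall>x. \<forall>u\<in>U. \<forall>i.
          has_lions_derivative M (\<lambda>\<mu>. b t x \<mu> u $ i) (\<lambda>\<mu> v. Dmub t x \<mu> u v $ i)) \<and>
       continuous_map
         (prod_topology euclidean (prod_topology W2_topology (prod_topology (top_of_set U) euclidean)))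
         euclidean (\<lambda>(x, \<mu>, u, v). Dmub t x \<mu> u v)) \<and>
    (\<exists>C. \<forall>t\<in>{0..T}. \<forall>x. \<forall>\<mu>\<in>P2. \<forall>u\<in>U. \<forall>v. norm (Dmub t x \<mu> u v) \<le> C) \<and>
    (\<forall>t\<in>{0..T}.
       (\<forall>x. \<forall>u\<in>U. has_lions_derivative M (\<lambda>\<mu>. f t x \<mu> u) (\<lambda>\<mu> v. Dmuf t x \<mu> u v)) \<and>
       continuous_map
         (prod_topology euclidean (prod_topology W2_topology (prod_topology (top_of_set U) euclidean)))
         euclidean (\<lambda>(x, \<mu>, u, v). Dmuf t x \<mu> u v)) \<and>
    (\<exists>C. \<forall>t\<in>{0..T}. \<forall>x. \<forall>\<mu>\<in>P2. \<forall>u\<in>U. \<forall>v.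
       norm (Dmuf t x \<mu> u v) \<le> C * (1 + norm x + norm u + norm v + sqrt (second_moment \<mu>))) \<and>
    (\<forall>x. has_lions_derivative M (\<lambda>\<mu>. g x \<mu>) (\<lambda>\<mu> v. Dmug x \<mu> v)) \<and>
    continuous_map (prod_topology euclidean (prod_topology W2_topology euclidean)) euclidean
      (\<lambda>(x, \<mu>, v). Dmug x \<mu> v) \<and>
    (\<exists>C. \<forall>x. \<forall>\<mu>\<in>P2. \<forall>v.
       norm (Dmug x \<mu> v) \<le> C * (1 + norm x + norm v + sqrt (second_moment \<mu>)))"


section \<open>Probabilistic notions\<close>

definition brownian_motion ::
  "'a measure \<Rightarrow> (real \<Rightarrow> 'a measure) \<Rightarrow> real \<Rightarrow> (real \<Rightarrow> 'a \<Rightarrow> real^'m) \<Rightarrow> bool" where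
  "brownian_motion M F T W \<longleftrightarrow>
    (AE \<omega> in M. W 0 \<omega> = 0) \<and>
    (AE \<omega> in M. continuous_on {0..T} (\<lambda>t. W t \<omega>)) \<and>
    (\<forall>t\<in>{0..T}. W t \<in> borel_measurable (F t)) \<and>
    (\<forall>s t. 0 \<le> s \<and> s < t \<and> t \<le> T \<longrightarrow>
       prob_space.indep_set M (sets (F s))
         (sets (vimage_algebra (space M) (\<lambda>\<omega>. W t \<omega> - W s \<omega>) borel)) \<and>
       distributed M lborel (\<lambda>\<omega>. W t \<omega> - W s \<omega>)
         (\<lambda>x. ennreal (\<Prod>j\<in>UNIV. normal_density 0 (sqrt (t - s)) (x $ j))))"

text \<open>Componentwise conditional expectation of vectors and matrices.\<close>

definition cond_expectation ::
  "'a measure \<Rightarrow> 'a measure \<Rightarrow> ('a \<Rightarrow> 'v::euclidean_space) \<Rightarrow> 'a \<Rightarrow> 'v" where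
  "cond_expectation M G X \<omega> = (\<Sum>i\<in>Basis. real_cond_exp M G (\<lambda>\<omega>'. X \<omega>' \<bullet> i) \<omega> *\<^sub>R i)"

definition outer_product :: "real^'d \<Rightarrow> real^'m \<Rightarrow> real^'m^'d" where
  "outer_product y w = (\<chi> i j. y $ i * w $ j)"

text \<open>The family \<open>V'\<close> on \<open>M'\<close> has the same joint law as the family \<open>V\<close> on \<open>M\<close>.  Put on the second
  factor of the product space of \<open>M\<close> and \<open>M'\<close>, it is an independent copy of \<open>V\<close>, and the
  expectation over the copy only is the integral with respect to \<open>M'\<close>.\<close>

definition copy_of_family ::
  "'b measure \<Rightarrow> ('i \<Rightarrow> 'b \<Rightarrow> 'v::euclidean_space) \<Rightarrow> 'a measure \<Rightarrow> ('i \<Rightarrow> 'a \<Rightarrow> 'v) \<Rightarrow> 'i set \<Rightarrow> bool"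
where
  "copy_of_family M' V' M V I \<longleftrightarrow>
    (\<forall>i\<in>I. V' i \<in> borel_measurable M') \<and> (\<forall>i\<in>I. V i \<in> borel_measurable M) \<and>
    distr M' (\<Pi>\<^sub>M i\<in>I. borel) (\<lambda>\<omega>. \<lambda>i\<in>I. V' i \<omega>) = distr M (\<Pi>\<^sub>M i\<in>I. borel) (\<lambda>\<omega>. \<lambda>i\<in>I. V i \<omega>)"

end

theory Submission
  imports Defs
begin

text \<open>Since \<open>H\<close> is affine in \<open>(y, z)\<close> with \<open>F(t n)\<close>-measurable coefficients, taking \<open>F(t n)\<close>-conditional
  expectations in the sample-wise recursion gives the backward Euler scheme, provided that at step
  \<open>n + 1\<close> both processes have the same \<open>F(t (n + 1))\<close>-conditional expectation: the increment and the Lions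
  derivative of \<open>b\<close> at step \<open>n\<close> are \<open>F(t (n + 1))\<close>-measurable, so the tower property replaces one process by the other
  in the \<open>z\<close>-equation and in the mean-field term.  In this form the induction starts trivially at \<open>N\<close>.

  Integrability is the delicate point: the sample-wise process is multiplied by an unbounded Gaussian increment
  at every step, so it need not stay square-integrable.  What is preserved is integrability
  against every random variable with moments of all orders.\<close>

section \<open>Integrability against random variables with all moments\<close>

text \<open>Square integrability is lost because \<open>Ybar (Suc n)\<close> depends on
  \<open>dW n\<close> through \<open>X (Suc n)\<close>: the factors of their product are not
  independent, and Hoelder's inequality only yields exponents below 2. The data do not supply higher
  moments to compensate, since \<open>X n\<close> and \<open>u n\<close> are merely square
  integrable and the derivatives of \<open>f\<close> and \<open>g\<close> may grow linearly. The
  class \<open>moderate\<close> is therefore defined by its test factors. Variables with moments of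
  all orders are closed under products, so an increment is absorbed into the test factor, while
  \<open>L2\<close> stays inside the class. Stability under conditional expectation comes from
  duality: the factor |Q| is traded for its conditional expectation, which keeps all moments by
  Jensen's inequality. The expectation over the copy sees only joint laws, so it can be rewritten
  over \<open>M\<close> with the outer state frozen at a point x. This gives one deterministic
  function of x that serves both recursions, and its value at \<open>X n\<close> is adapted and
  square integrable.\<close>

definition has_all_moments :: "'a measure \<Rightarrow> ('a \<Rightarrow> real) \<Rightarrow> bool" where
  "has_all_moments M Q \<longleftrightarrow> Q \<in> borel_measurable M \<and> (\<forall>k. integrable M (\<lambda>\<omega>. Q \<omega> ^ k))"

text \<open>By Hoelder's inequality the class contains every L^p with p > 1. Quantifying over all
  test factors \<open>Q\<close> avoids tracking the exponent, which would have to be lowered at each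
  time step.\<close>

definition moderate :: "'a measure \<Rightarrow> ('a \<Rightarrow> 'v::euclidean_space) \<Rightarrow> bool" where
  "moderate M V \<longleftrightarrow> V \<in> borel_measurable M \<and>
    (\<forall>Q. has_all_moments M Q \<longrightarrow> integrable M (\<lambda>\<omega>. Q \<omega> *\<^sub>R V \<omega>))"

lemma moderate_measurable: "moderate M V \<Longrightarrow> V \<in> borel_measurable M"
  by (simp add: moderate_def)

lemma abs_power_le_one_plus_even_power:
  fixes x :: real
  shows "\<bar>x\<bar> ^ k \<le> 1 + x ^ (2 * k)"
proof -
  have "2 * \<bar>x\<bar> ^ k \<le> 1 + (\<bar>x\<bar> ^ k)\<^sup>2"
    using sum_squares_bound[of 1 "\<bar>x\<bar> ^ k"] by simp
  moreover have "(\<bar>x\<bar> ^ k)\<^sup>2 = x ^ (2 * k)"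
    by (simp add: power_even_abs mult.commute[of k] flip: power_mult)
  ultimately show ?thesis
    using zero_le_power[OF abs_ge_zero, of x k] by linarith
qed

text \<open>On a finite measure any moment is dominated by 1 plus an even one. Even powers are the
  convenient ones because they are convex on the whole line, as Jensen's inequality
  requires.\<close>

lemma (in finite_measure) has_all_momentsI_even:
  assumes [measurable]: "Q \<in> borel_measurable M"
    and even: "\<And>k. integrable M (\<lambda>\<omega>. Q \<omega> ^ (2 * k))"
  shows "has_all_moments M Q"
  unfolding has_all_moments_def
proof (intro conjI allI assms(1))
  fix k
  show "integrable M (\<lambda>\<omega>. Q \<omega> ^ k)"
  proof (rule Bochner_Integration.integrable_bound)
    show "integrable M (\<lambda>\<omega>. 1 + Q \<omega> ^ (2 * k))" using even by auto
    show "AE \<omega> in M. norm (Q \<omega> ^ k) \<le> norm (1 + Q \<omega> ^ (2 * k))"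
      using abs_power_le_one_plus_even_power by (auto simp: power_abs intro!: AE_I2 order_trans[OF _ abs_ge_self])
  qed measurable
qed

lemma (in finite_measure) has_all_moments_bounded:
  assumes [measurable]: "Q \<in> borel_measurable M" and "\<And>\<omega>. \<omega> \<in> space M \<Longrightarrow> \<bar>Q \<omega>\<bar> \<le> C"
  shows "has_all_moments M Q"
  unfolding has_all_moments_def
proof (intro conjI allI assms(1))
  fix k
  show "integrable M (\<lambda>\<omega>. Q \<omega> ^ k)"
  proof (rule integrable_const_bound[where B = "C ^ k"])
    show "AE \<omega> in M. norm (Q \<omega> ^ k) \<le> C ^ k"
      using assms(2) by (auto simp: power_abs intro!: power_mono AE_I2)
  qed measurable
qed

text \<open>From 2qr \<le> q^2 + r^2 with q = |Q|^k and r = |R|^k, the moment of order k of the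
  product is controlled by the moments of order 2k of the factors.\<close>

lemma has_all_moments_mult:
  assumes Q: "has_all_moments M Q" and R: "has_all_moments M R"
  shows "has_all_moments M (\<lambda>\<omega>. Q \<omega> * R \<omega>)"
  unfolding has_all_moments_def
proof (intro conjI allI)
  have [measurable]: "Q \<in> borel_measurable M" "R \<in> borel_measurable M"
    using Q R by (auto simp: has_all_moments_def)
  show "(\<lambda>\<omega>. Q \<omega> * R \<omega>) \<in> borel_measurable M" by measurable
  fix k
  show "integrable M (\<lambda>\<omega>. (Q \<omega> * R \<omega>) ^ k)"
  proof (rule Bochner_Integration.integrable_bound)
    show "integrable M (\<lambda>\<omega>. Q \<omega> ^ (k * 2) + R \<omega> ^ (k * 2))"
      using Q R by (auto simp: has_all_moments_def)
    show "AE \<omega> in M. norm ((Q \<omega> * R \<omega>) ^ k) \<le> norm (Q \<omega> ^ (k * 2) + R \<omega> ^ (k * 2))"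
    proof (intro AE_I2)
      fix \<omega>
      let ?q = "\<bar>Q \<omega> ^ k\<bar>" and ?r = "\<bar>R \<omega> ^ k\<bar>"
      have "2 * ?q * ?r \<le> ?q\<^sup>2 + ?r\<^sup>2" by (rule sum_squares_bound)
      moreover have "0 \<le> ?q * ?r" by simp
      ultimately have "?q * ?r \<le> ?q\<^sup>2 + ?r\<^sup>2" by linarith
      then show "norm ((Q \<omega> * R \<omega>) ^ k) \<le> norm (Q \<omega> ^ (k * 2) + R \<omega> ^ (k * 2))"
        by (simp add: power_mult_distrib abs_mult power_mult)
    qed
  qed measurable
qed

lemma moderate_add: "moderate M V \<Longrightarrow> moderate M V' \<Longrightarrow> moderate M (\<lambda>\<omega>. V \<omega> + V' \<omega>)"
  unfolding moderate_def scaleR_add_right by (auto intro: Bochner_Integration.integrable_add borel_measurable_add)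

lemma moderate_sum: "(\<And>i. i \<in> I \<Longrightarrow> moderate M (V i)) \<Longrightarrow> moderate M (\<lambda>\<omega>. \<Sum>i\<in>I. V i \<omega>)"
  unfolding moderate_def scaleR_sum_right by (auto intro!: Bochner_Integration.integrable_sum borel_measurable_sum)

text \<open>A test factor times \<open>Q\<close> is again a test factor. This is how multiplication
  by a Gaussian increment stays inside the class.\<close>

lemma moderate_scaleR:
  "has_all_moments M Q \<Longrightarrow> moderate M V \<Longrightarrow> moderate M (\<lambda>\<omega>. Q \<omega> *\<^sub>R V \<omega>)"
  using has_all_moments_mult[of M _ Q] by (auto simp: moderate_def has_all_moments_def)

lemma moderate_bounded_linear:
  assumes "bounded_linear L" "moderate M V"
  shows "moderate M (\<lambda>\<omega>. L (V \<omega>))"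
proof -
  interpret bounded_linear L by fact
  show ?thesis
    unfolding moderate_def
  proof (intro conjI allI impI)
    have "L \<in> borel_measurable borel"
      by (rule borel_measurable_continuous_onI[OF linear_continuous_on[OF assms(1)]])
    then show "(\<lambda>\<omega>. L (V \<omega>)) \<in> borel_measurable M"
      by (rule measurable_compose[OF moderate_measurable[OF assms(2)]])
    fix Q assume "has_all_moments M Q"
    then have "integrable M (\<lambda>\<omega>. Q \<omega> *\<^sub>R V \<omega>)" using assms(2) by (simp add: moderate_def)
    from integrable_bounded_linear[OF assms(1) this]
    show "integrable M (\<lambda>\<omega>. Q \<omega> *\<^sub>R L (V \<omega>))" by (simp only: scaleR)
  qed
qed

text \<open>The recursions determine the processes only up to null sets, so membership has to pass
  to almost everywhere equal versions.\<close>

lemma moderate_AE_cong: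
  assumes "AE \<omega> in M. V \<omega> = V' \<omega>" "V \<in> borel_measurable M" "moderate M V'"
  shows "moderate M V"
  unfolding moderate_def
proof (intro conjI allI impI assms(2))
  fix Q assume Q: "has_all_moments M Q"
  then have "integrable M (\<lambda>\<omega>. Q \<omega> *\<^sub>R V' \<omega>)" using assms(3) by (auto simp: moderate_def)
  moreover have [measurable]: "V \<in> borel_measurable M" "V' \<in> borel_measurable M" "Q \<in> borel_measurable M"
    using assms Q by (auto simp: moderate_def has_all_moments_def)
  ultimately show "integrable M (\<lambda>\<omega>. Q \<omega> *\<^sub>R V \<omega>)"
    using assms(1) by (subst integrable_cong_AE[where g = "\<lambda>\<omega>. Q \<omega> *\<^sub>R V' \<omega>"]) auto
qed

lemma (in finite_measure) moderate_integrable: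
  assumes "moderate M V"
  shows "integrable M V"
proof -
  have "has_all_moments M (\<lambda>_. 1)" by (intro has_all_moments_bounded[where C = 1]) auto
  then have "integrable M (\<lambda>\<omega>. 1 *\<^sub>R V \<omega>)" using assms unfolding moderate_def by blast
  then show ?thesis by simp
qed

text \<open>The bound is |Q| |V| \<le> Q^2 + |V|^2. This is the entrance to the class: the terminal
  value, the gradient of \<open>f\<close> and the mean-field term all enter as square-integrable
  variables.\<close>

lemma moderate_L2:
  assumes V: "V \<in> L2 M"
  shows "moderate M V"
  unfolding moderate_def
proof (intro conjI allI impI)
  show [measurable]: "V \<in> borel_measurable M" using V by (simp add: L2_def)
  fix Q assume Q: "has_all_moments M Q"
  then have [measurable]: "Q \<in> borel_measurable M" by (simp add: has_all_moments_def)
  show "integrable M (\<lambda>\<omega>. Q \<omega> *\<^sub>R V \<omega>)"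
  proof (rule Bochner_Integration.integrable_bound)
    show "integrable M (\<lambda>\<omega>. (Q \<omega>)\<^sup>2 + (norm (V \<omega>))\<^sup>2)"
      using Q V by (auto simp: has_all_moments_def L2_def)
    show "AE \<omega> in M. norm (Q \<omega> *\<^sub>R V \<omega>) \<le> norm ((Q \<omega>)\<^sup>2 + (norm (V \<omega>))\<^sup>2)"
    proof (intro AE_I2)
      fix \<omega>
      have "2 * \<bar>Q \<omega>\<bar> * norm (V \<omega>) \<le> \<bar>Q \<omega>\<bar>\<^sup>2 + (norm (V \<omega>))\<^sup>2" by (rule sum_squares_bound)
      moreover have "0 \<le> \<bar>Q \<omega>\<bar> * norm (V \<omega>)" by simp
      ultimately have "\<bar>Q \<omega>\<bar> * norm (V \<omega>) \<le> \<bar>Q \<omega>\<bar>\<^sup>2 + (norm (V \<omega>))\<^sup>2" by linarith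
      then show "norm (Q \<omega> *\<^sub>R V \<omega>) \<le> norm ((Q \<omega>)\<^sup>2 + (norm (V \<omega>))\<^sup>2)" by simp
    qed
  qed measurable
qed

lemma moderate_componentwise:
  fixes V :: "'a \<Rightarrow> 'v::euclidean_space"
  assumes "\<And>i. i \<in> Basis \<Longrightarrow> moderate M (\<lambda>\<omega>. V \<omega> \<bullet> i)"
  shows "moderate M V"
proof -
  have "moderate M (\<lambda>\<omega>. \<Sum>i\<in>Basis. (V \<omega> \<bullet> i) *\<^sub>R i)"
    by (intro moderate_sum moderate_bounded_linear[OF bounded_linear_scaleR_left] assms)
  then show ?thesis by (simp add: euclidean_representation)
qed

lemma moderate_inner:
  fixes B V :: "'a \<Rightarrow> 'v::euclidean_space"
  assumes "\<And>i. i \<in> Basis \<Longrightarrow> has_all_moments M (\<lambda>\<omega>. B \<omega> \<bullet> i)" "moderate M V"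
  shows "moderate M (\<lambda>\<omega>. B \<omega> \<bullet> V \<omega>)"
proof -
  have "moderate M (\<lambda>\<omega>. \<Sum>i\<in>Basis. (B \<omega> \<bullet> i) *\<^sub>R (V \<omega> \<bullet> i))"
    by (intro moderate_sum moderate_scaleR assms moderate_bounded_linear[OF bounded_linear_inner_left])
  then show ?thesis by (simp add: euclidean_inner[of "B _" "V _"])
qed

section \<open>Stability of both classes under conditional expectation\<close>

context finite_measure_subalgebra
begin

text \<open>\<open>real_cond_exp\<close> is a difference of two nonnegative conditional expectations
  converted to real numbers. Here the one of the negative part vanishes, and integrability makes the
  other finite almost everywhere, so the conversion loses nothing.\<close>

lemma nn_cond_exp_eq_real_cond_exp:
  assumes "integrable M f" "\<And>\<omega>. 0 \<le> f \<omega>"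
  shows "AE \<omega> in M. nn_cond_exp M F (\<lambda>x. ennreal (f x)) \<omega> = ennreal (real_cond_exp M F f \<omega>)"
proof -
  have [measurable]: "f \<in> borel_measurable M" using assms by auto
  have "(\<integral>\<^sup>+ x. nn_cond_exp M F (\<lambda>x. ennreal (f x)) x \<partial>M) = (\<integral>\<^sup>+ x. ennreal (f x) \<partial>M)"
    using nn_cond_exp_intg[of "\<lambda>_. 1" "\<lambda>x. ennreal (f x)"] by simp
  also have "\<dots> < \<infinity>" using assms by (simp add: nn_integral_eq_integral)
  finally have "AE \<omega> in M. nn_cond_exp M F (\<lambda>x. ennreal (f x)) \<omega> \<noteq> \<infinity>"
    by (intro nn_integral_PInf_AE) auto
  moreover have "(\<lambda>x. ennreal (- f x)) = (\<lambda>_. 0)" using assms(2) by (auto simp: ennreal_neg)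
  then have "AE \<omega> in M. 0 = nn_cond_exp M F (\<lambda>x. ennreal (- f x)) \<omega>"
    using nn_cond_exp_F_meas[of "\<lambda>_. 0"] by auto
  ultimately show ?thesis
  proof eventually_elim
    case (elim \<omega>)
    then show ?case by (simp add: real_cond_exp_def flip: elim(2)) (simp add: less_top)
  qed
qed

text \<open>Conditional Jensen inequality for the convex functions x^(2k).\<close>

lemma has_all_moments_real_cond_exp:
  assumes "has_all_moments M Q"
  shows "has_all_moments M (real_cond_exp M F Q)"
proof (rule has_all_momentsI_even)
  fix k
  have Q: "integrable M (\<lambda>\<omega>. Q \<omega> ^ k)" for k using assms by (simp add: has_all_moments_def)
  show "integrable M (\<lambda>\<omega>. real_cond_exp M F Q \<omega> ^ (2 * k))"
    using Q[of 1] Q[of "2 * k"]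
    by (intro integrable_convex_cond_exp[where I = UNIV]) (auto intro!: convex_power_even)
qed measurable

text \<open>Conditional expectation is self-adjoint: the integral of |Q| E[|V| | F] equals that of
  E[|Q| | F] |V|, and E[|Q| | F] is again a test factor. The exchange is made with
  \<open>nn_cond_exp\<close>, where it holds before any integrability is known.\<close>

lemma moderate_real_cond_exp:
  fixes V :: "'a \<Rightarrow> real"
  assumes V: "moderate M V"
  shows "moderate M (real_cond_exp M F V)"
  unfolding moderate_def
proof (intro conjI allI impI)
  show "real_cond_exp M F V \<in> borel_measurable M" by measurable
  fix Q assume Q: "has_all_moments M Q"
  have [measurable]: "V \<in> borel_measurable M" "Q \<in> borel_measurable M"
    using V Q by (auto simp: moderate_def has_all_moments_def)
  define A where "A = (\<lambda>\<omega>. \<bar>Q \<omega>\<bar>)"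
  have A: "has_all_moments M A"
    using Q by (intro has_all_momentsI_even) (auto simp: has_all_moments_def A_def power_even_abs)
  have A_nonneg: "0 \<le> A \<omega>" for \<omega> by (simp add: A_def)
  have intA: "integrable M A" using A unfolding has_all_moments_def by (auto dest: spec[of _ 1])
  have [measurable]: "A \<in> borel_measurable M" using intA by auto
  have EA: "has_all_moments M (real_cond_exp M F A)" by (rule has_all_moments_real_cond_exp[OF A])
  \<comment> \<open>The hypothesis on \<open>V\<close> is used against the conditional expectation
    of |Q|, not against \<open>Q\<close> itself.\<close>
  have "integrable M (\<lambda>\<omega>. real_cond_exp M F A \<omega> *\<^sub>R V \<omega>)" using V EA by (auto simp: moderate_def)
  from integrable_norm[OF this]
  have fin: "(\<integral>\<^sup>+ \<omega>. ennreal (\<bar>real_cond_exp M F A \<omega>\<bar> * \<bar>V \<omega>\<bar>) \<partial>M) < \<infinity>"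
    by (simp add: integrable_iff_bounded abs_mult)
  let ?E = "nn_cond_exp M F (\<lambda>x. ennreal \<bar>V x\<bar>)"
  show "integrable M (\<lambda>\<omega>. Q \<omega> *\<^sub>R real_cond_exp M F V \<omega>)"
  proof (rule integrableI_bounded)
    have "(\<integral>\<^sup>+ \<omega>. ennreal (norm (Q \<omega> *\<^sub>R real_cond_exp M F V \<omega>)) \<partial>M) \<le> (\<integral>\<^sup>+ \<omega>. ?E \<omega> * ennreal (A \<omega>) \<partial>M)"
    proof (rule nn_integral_mono_AE)
      show "AE \<omega> in M. ennreal (norm (Q \<omega> *\<^sub>R real_cond_exp M F V \<omega>)) \<le> ?E \<omega> * ennreal (A \<omega>)"
        using real_cond_exp_abs[OF \<open>V \<in> borel_measurable M\<close>]
      proof eventually_elim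
        case (elim \<omega>)
        have "ennreal (norm (Q \<omega> *\<^sub>R real_cond_exp M F V \<omega>)) = ennreal \<bar>real_cond_exp M F V \<omega>\<bar> * ennreal (A \<omega>)"
          by (simp add: A_def abs_mult mult.commute flip: ennreal_mult')
        also have "\<dots> \<le> ?E \<omega> * ennreal (A \<omega>)" using elim by (intro mult_right_mono) auto
        finally show ?case .
      qed
    qed
    also have "\<dots> = (\<integral>\<^sup>+ \<omega>. ?E \<omega> * nn_cond_exp M F (\<lambda>x. ennreal (A x)) \<omega> \<partial>M)"
      by (intro nn_cond_exp_intg[symmetric]) auto
    also have "\<dots> = (\<integral>\<^sup>+ \<omega>. nn_cond_exp M F (\<lambda>x. ennreal (A x)) \<omega> * ?E \<omega> \<partial>M)"
      by (simp add: mult.commute)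
    also have "\<dots> = (\<integral>\<^sup>+ \<omega>. nn_cond_exp M F (\<lambda>x. ennreal (A x)) \<omega> * ennreal \<bar>V \<omega>\<bar> \<partial>M)"
      by (intro nn_cond_exp_intg) auto
    also have "\<dots> \<le> (\<integral>\<^sup>+ \<omega>. ennreal (\<bar>real_cond_exp M F A \<omega>\<bar> * \<bar>V \<omega>\<bar>) \<partial>M)"
    proof (rule nn_integral_mono_AE)
      show "AE \<omega> in M. nn_cond_exp M F (\<lambda>x. ennreal (A x)) \<omega> * ennreal \<bar>V \<omega>\<bar>
          \<le> ennreal (\<bar>real_cond_exp M F A \<omega>\<bar> * \<bar>V \<omega>\<bar>)"
        using nn_cond_exp_eq_real_cond_exp[OF intA A_nonneg]
      proof eventually_elim
        case (elim \<omega>)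
        have "ennreal (real_cond_exp M F A \<omega>) * ennreal \<bar>V \<omega>\<bar> \<le> ennreal \<bar>real_cond_exp M F A \<omega>\<bar> * ennreal \<bar>V \<omega>\<bar>"
          by (intro mult_right_mono ennreal_leI) auto
        then show ?case using elim by (simp add: A_def ennreal_mult' del: abs_mult)
      qed
    qed
    also note fin
    finally show "(\<integral>\<^sup>+ \<omega>. ennreal (norm (Q \<omega> *\<^sub>R real_cond_exp M F V \<omega>)) \<partial>M) < \<infinity>" .
  qed measurable
qed

end

section \<open>Vector-valued conditional expectations and the backward step\<close>

lemma cond_expectation_inner:
  fixes X :: "'a \<Rightarrow> 'v::euclidean_space"
  assumes "i \<in> Basis"
  shows "cond_expectation M G X \<omega> \<bullet> i = real_cond_exp M G (\<lambda>\<omega>'. X \<omega>' \<bullet> i) \<omega>"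
  using assms by (simp add: cond_expectation_def inner_sum_left inner_Basis if_distrib sum.delta cong: if_cong)

lemma measurable_cond_expectation [measurable]:
  fixes X :: "'a \<Rightarrow> 'v::euclidean_space"
  shows "cond_expectation M G X \<in> borel_measurable G" "cond_expectation M G X \<in> borel_measurable M"
  unfolding cond_expectation_def[abs_def] by measurable

lemma borel_measurable_vec_nth [measurable]:
  fixes V :: "'a \<Rightarrow> ('b::euclidean_space)^'n"
  assumes "V \<in> borel_measurable M"
  shows "(\<lambda>\<omega>. V \<omega> $ i) \<in> borel_measurable M"
  using assms by (rule measurable_compose)
    (intro borel_measurable_continuous_onI linear_continuous_on bounded_linear_vec_nth)

lemma AE_eq_componentwise:
  fixes V W :: "'a \<Rightarrow> 'v::euclidean_space"
  assumes "\<And>i. i \<in> Basis \<Longrightarrow> AE \<omega> in M. V \<omega> \<bullet> i = W \<omega> \<bullet> i"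
  shows "AE \<omega> in M. V \<omega> = W \<omega>"
proof -
  have "AE \<omega> in M. \<forall>i\<in>Basis. V \<omega> \<bullet> i = W \<omega> \<bullet> i"
    by (intro AE_finite_allI assms) auto
  then show ?thesis by eventually_elim (blast intro: euclidean_eqI)
qed

context finite_measure_subalgebra
begin

lemma cond_expectation_cong_AE:
  fixes V W :: "'a \<Rightarrow> 'v::euclidean_space"
  assumes eq: "AE \<omega> in M. V \<omega> = W \<omega>" and [measurable]: "V \<in> borel_measurable M" "W \<in> borel_measurable M"
  shows "AE \<omega> in M. cond_expectation M F V \<omega> = cond_expectation M F W \<omega>"
proof (rule AE_eq_componentwise)
  fix i :: 'v assume i: "i \<in> Basis"
  have "AE \<omega> in M. V \<omega> \<bullet> i = W \<omega> \<bullet> i" using eq by eventually_elim simp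
  then show "AE \<omega> in M. cond_expectation M F V \<omega> \<bullet> i = cond_expectation M F W \<omega> \<bullet> i"
    unfolding cond_expectation_inner[OF i] by (intro real_cond_exp_cong) auto
qed

lemma cond_expectation_add:
  fixes V W :: "'a \<Rightarrow> 'v::euclidean_space"
  assumes "integrable M V" "integrable M W"
  shows "AE \<omega> in M. cond_expectation M F (\<lambda>\<omega>. V \<omega> + W \<omega>) \<omega> = cond_expectation M F V \<omega> + cond_expectation M F W \<omega>"
proof (rule AE_eq_componentwise)
  fix i :: 'v assume i: "i \<in> Basis"
  show "AE \<omega> in M. cond_expectation M F (\<lambda>\<omega>. V \<omega> + W \<omega>) \<omega> \<bullet> i = (cond_expectation M F V \<omega> + cond_expectation M F W \<omega>) \<bullet> i"
    unfolding cond_expectation_inner[OF i] inner_add_left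
    using assms by (intro real_cond_exp_add) auto
qed

lemma cond_expectation_scaleR:
  fixes V :: "'a \<Rightarrow> 'v::euclidean_space"
  assumes "integrable M V"
  shows "AE \<omega> in M. cond_expectation M F (\<lambda>\<omega>. c *\<^sub>R V \<omega>) \<omega> = c *\<^sub>R cond_expectation M F V \<omega>"
proof (rule AE_eq_componentwise)
  fix i :: 'v assume i: "i \<in> Basis"
  show "AE \<omega> in M. cond_expectation M F (\<lambda>\<omega>. c *\<^sub>R V \<omega>) \<omega> \<bullet> i = (c *\<^sub>R cond_expectation M F V \<omega>) \<bullet> i"
    unfolding inner_scaleR_left cond_expectation_inner[OF i]
    using assms by (intro real_cond_exp_cmult) auto
qed

lemma cond_expectation_F_meas:
  fixes V :: "'a \<Rightarrow> 'v::euclidean_space"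
  assumes "integrable M V" "V \<in> borel_measurable F"
  shows "AE \<omega> in M. cond_expectation M F V \<omega> = V \<omega>"
proof (rule AE_eq_componentwise)
  fix i :: 'v assume i: "i \<in> Basis"
  show "AE \<omega> in M. cond_expectation M F V \<omega> \<bullet> i = V \<omega> \<bullet> i"
    unfolding cond_expectation_inner[OF i] using assms by (intro real_cond_exp_F_meas) auto
qed

lemma integrable_cond_expectation:
  fixes V :: "'a \<Rightarrow> 'v::euclidean_space"
  assumes "integrable M V"
  shows "integrable M (cond_expectation M F V)"
  unfolding cond_expectation_def[abs_def] using assms
  by (auto intro!: Bochner_Integration.integrable_sum integrable_scaleR_left real_cond_exp_int(1))

lemma integral_cond_expectation:
  fixes V :: "'a \<Rightarrow> 'v::euclidean_space"
  assumes V: "integrable M V"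
  shows "(\<integral>\<omega>. cond_expectation M F V \<omega> \<partial>M) = (\<integral>\<omega>. V \<omega> \<partial>M)"
proof (rule euclidean_eqI)
  fix i :: 'v assume i: "i \<in> Basis"
  show "(\<integral>\<omega>. cond_expectation M F V \<omega> \<partial>M) \<bullet> i = (\<integral>\<omega>. V \<omega> \<partial>M) \<bullet> i"
    using integrable_cond_expectation[OF V] V
    by (simp flip: integral_inner_left add: cond_expectation_inner[OF i] real_cond_exp_int(2))
qed

lemma moderate_cond_expectation:
  fixes V :: "'a \<Rightarrow> 'v::euclidean_space"
  assumes "moderate M V"
  shows "moderate M (cond_expectation M F V)"
proof (rule moderate_componentwise)
  fix i :: 'v assume i: "i \<in> Basis"
  show "moderate M (\<lambda>\<omega>. cond_expectation M F V \<omega> \<bullet> i)"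
    unfolding cond_expectation_inner[OF i]
    by (intro moderate_real_cond_exp moderate_bounded_linear[OF bounded_linear_inner_left] assms)
qed

text \<open>The F-measurable vector is pulled out one coordinate at a time, which is why
  integrability is asked of each product of coordinates and not of the inner product as a
  whole.\<close>

lemma real_cond_exp_inner:
  fixes B V :: "'a \<Rightarrow> 'v::euclidean_space"
  assumes B: "B \<in> borel_measurable F" and V: "integrable M V"
    and int: "\<And>i. i \<in> Basis \<Longrightarrow> integrable M (\<lambda>\<omega>. (B \<omega> \<bullet> i) * (V \<omega> \<bullet> i))"
  shows "AE \<omega> in M. real_cond_exp M F (\<lambda>\<omega>. B \<omega> \<bullet> V \<omega>) \<omega> = B \<omega> \<bullet> cond_expectation M F V \<omega>"
proof -
  \<comment> \<open>\<open>real_cond_exp_sum\<close> asks for integrability at every index, also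
    outside \<open>Basis\<close>; the value 0 there supplies it without changing the sum.\<close>
  let ?f = "\<lambda>i \<omega>. if i \<in> Basis then (B \<omega> \<bullet> i) * (V \<omega> \<bullet> i) else 0"
  have "AE \<omega> in M. real_cond_exp M F (\<lambda>\<omega>. \<Sum>i\<in>Basis. ?f i \<omega>) \<omega> = (\<Sum>i\<in>Basis. real_cond_exp M F (?f i) \<omega>)"
  proof (rule real_cond_exp_sum)
    show "integrable M (?f i)" for i using int by (cases "i \<in> Basis") auto
  qed
  moreover have "AE \<omega> in M. \<forall>i\<in>Basis. real_cond_exp M F (?f i) \<omega> = (B \<omega> \<bullet> i) * (cond_expectation M F V \<omega> \<bullet> i)"
  proof (intro AE_finite_allI)
    fix i :: 'v assume i: "i \<in> Basis"
    show "AE \<omega> in M. real_cond_exp M F (?f i) \<omega> = (B \<omega> \<bullet> i) * (cond_expectation M F V \<omega> \<bullet> i)"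
      unfolding cond_expectation_inner[OF i] if_P[OF i] using B V int[OF i]
      by (intro real_cond_exp_mult) auto
  qed simp
  ultimately show ?thesis
  proof eventually_elim
    case (elim \<omega>)
    have "real_cond_exp M F (\<lambda>\<omega>. B \<omega> \<bullet> V \<omega>) \<omega> = real_cond_exp M F (\<lambda>\<omega>. \<Sum>i\<in>Basis. ?f i \<omega>) \<omega>"
      by (rule arg_cong2[where f = "real_cond_exp M F"]) (auto simp: euclidean_inner[of "B _" "V _"])
    also have "\<dots> = B \<omega> \<bullet> cond_expectation M F V \<omega>"
      unfolding elim(1) euclidean_inner[of "B \<omega>" "cond_expectation M F V \<omega>"]
      using elim(2) by (intro sum.cong refl) (rule bspec)
    finally show ?case .
  qed
qed

text \<open>This is the Euler step as an affine map of \<open>(y, z)\<close>: \<open>a\<close> will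
  be the gradient of \<open>f\<close>, and \<open>B i\<close>, \<open>S i\<close> the derivatives of
  \<open>b\<close> and \<open>\<sigma>\<close> in direction \<open>i\<close>. Boundedness of
  \<open>B i\<close> and \<open>S i\<close> lets mere integrability of \<open>y\<close> and
  \<open>z\<close> suffice.\<close>

lemma cond_expectation_affine:
  fixes a y :: "'a \<Rightarrow> 'v::euclidean_space" and z :: "'a \<Rightarrow> 'w::euclidean_space"
  assumes a: "integrable M a" "a \<in> borel_measurable F"
    and y: "integrable M y" and z: "integrable M z"
    and B: "\<And>i. i \<in> Basis \<Longrightarrow> B i \<in> borel_measurable F" "\<And>i \<omega>. i \<in> Basis \<Longrightarrow> \<omega> \<in> space M \<Longrightarrow> norm (B i \<omega>) \<le> C"
    and S: "\<And>i. i \<in> Basis \<Longrightarrow> S i \<in> borel_measurable F" "\<And>i \<omega>. i \<in> Basis \<Longrightarrow> \<omega> \<in> space M \<Longrightarrow> norm (S i \<omega>) \<le> C"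
  shows "AE \<omega> in M. cond_expectation M F (\<lambda>\<omega>. y \<omega> + c *\<^sub>R (a \<omega> + (\<Sum>i\<in>Basis. (B i \<omega> \<bullet> y \<omega> + S i \<omega> \<bullet> z \<omega>) *\<^sub>R i))) \<omega>
     = cond_expectation M F y \<omega> + c *\<^sub>R (a \<omega> + (\<Sum>i\<in>Basis. (B i \<omega> \<bullet> cond_expectation M F y \<omega> + S i \<omega> \<bullet> cond_expectation M F z \<omega>) *\<^sub>R i))"
proof (rule AE_eq_componentwise)
  fix i :: 'v assume i: "i \<in> Basis"
  have bdd: "integrable M (\<lambda>\<omega>. Q \<omega> * V \<omega>)"
    if V: "integrable M V" and Q: "Q \<in> borel_measurable F" and le: "\<And>\<omega>. \<omega> \<in> space M \<Longrightarrow> \<bar>Q \<omega>\<bar> \<le> C" for Q V :: "'a \<Rightarrow> real"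
  proof (rule Bochner_Integration.integrable_bound)
    show "integrable M (\<lambda>\<omega>. C * V \<omega>)" using V by simp
    have [measurable]: "Q \<in> borel_measurable M" "V \<in> borel_measurable M"
      using Q V measurable_from_subalg[OF subalg] by auto
    show "(\<lambda>\<omega>. Q \<omega> * V \<omega>) \<in> borel_measurable M" by measurable
    show "AE \<omega> in M. norm (Q \<omega> * V \<omega>) \<le> norm (C * V \<omega>)"
      using le by (auto simp: abs_mult intro!: AE_I2 mult_right_mono order_trans[OF le])
  qed
  have [measurable]: "B i \<in> borel_measurable F" "S i \<in> borel_measurable F" using B S i by auto
  have intB: "integrable M (\<lambda>\<omega>. (B i \<omega> \<bullet> j) * (y \<omega> \<bullet> j))" if "j \<in> Basis" for j
    using y B(2)[OF i] that by (intro bdd) (auto intro: order_trans[OF Basis_le_norm])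
  have intS: "integrable M (\<lambda>\<omega>. (S i \<omega> \<bullet> j) * (z \<omega> \<bullet> j))" if "j \<in> Basis" for j
    using z S(2)[OF i] that by (intro bdd) (auto intro: order_trans[OF Basis_le_norm])
  have intB': "integrable M (\<lambda>\<omega>. B i \<omega> \<bullet> y \<omega>)"
    by (subst euclidean_inner) (intro Bochner_Integration.integrable_sum intB)
  have intS': "integrable M (\<lambda>\<omega>. S i \<omega> \<bullet> z \<omega>)"
    by (subst euclidean_inner) (intro Bochner_Integration.integrable_sum intS)
  have inti: "(V + c *\<^sub>R (A + (\<Sum>i\<in>Basis. R i *\<^sub>R i))) \<bullet> i = V \<bullet> i + c * (A \<bullet> i + R i)" for V A :: 'v and R
    using i by (simp add: inner_add_left inner_sum_left inner_Basis if_distrib sum.delta cong: if_cong)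
  have ai: "integrable M (\<lambda>\<omega>. a \<omega> \<bullet> i)" and yi: "integrable M (\<lambda>\<omega>. y \<omega> \<bullet> i)" using a y by auto
  have "AE \<omega> in M. real_cond_exp M F (\<lambda>\<omega>. y \<omega> \<bullet> i + c * (a \<omega> \<bullet> i + (B i \<omega> \<bullet> y \<omega> + S i \<omega> \<bullet> z \<omega>))) \<omega>
     = real_cond_exp M F (\<lambda>\<omega>. y \<omega> \<bullet> i) \<omega> + real_cond_exp M F (\<lambda>\<omega>. c * (a \<omega> \<bullet> i + (B i \<omega> \<bullet> y \<omega> + S i \<omega> \<bullet> z \<omega>))) \<omega>"
    using yi ai intB' intS' by (intro real_cond_exp_add) auto
  moreover have "AE \<omega> in M. real_cond_exp M F (\<lambda>\<omega>. c * (a \<omega> \<bullet> i + (B i \<omega> \<bullet> y \<omega> + S i \<omega> \<bullet> z \<omega>))) \<omega>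
     = c * real_cond_exp M F (\<lambda>\<omega>. a \<omega> \<bullet> i + (B i \<omega> \<bullet> y \<omega> + S i \<omega> \<bullet> z \<omega>)) \<omega>"
    using yi ai intB' intS' by (intro real_cond_exp_cmult) auto
  moreover have "AE \<omega> in M. real_cond_exp M F (\<lambda>\<omega>. a \<omega> \<bullet> i + (B i \<omega> \<bullet> y \<omega> + S i \<omega> \<bullet> z \<omega>)) \<omega>
     = real_cond_exp M F (\<lambda>\<omega>. a \<omega> \<bullet> i) \<omega> + real_cond_exp M F (\<lambda>\<omega>. B i \<omega> \<bullet> y \<omega> + S i \<omega> \<bullet> z \<omega>) \<omega>"
    using yi ai intB' intS' by (intro real_cond_exp_add) auto
  moreover have "AE \<omega> in M. real_cond_exp M F (\<lambda>\<omega>. B i \<omega> \<bullet> y \<omega> + S i \<omega> \<bullet> z \<omega>) \<omega>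
     = real_cond_exp M F (\<lambda>\<omega>. B i \<omega> \<bullet> y \<omega>) \<omega> + real_cond_exp M F (\<lambda>\<omega>. S i \<omega> \<bullet> z \<omega>) \<omega>"
    using yi ai intB' intS' by (intro real_cond_exp_add) auto
  moreover have "AE \<omega> in M. real_cond_exp M F (\<lambda>\<omega>. B i \<omega> \<bullet> y \<omega>) \<omega> = B i \<omega> \<bullet> cond_expectation M F y \<omega>"
    by (intro real_cond_exp_inner y intB) auto
  moreover have "AE \<omega> in M. real_cond_exp M F (\<lambda>\<omega>. S i \<omega> \<bullet> z \<omega>) \<omega> = S i \<omega> \<bullet> cond_expectation M F z \<omega>"
    by (intro real_cond_exp_inner z intS) auto
  moreover have "AE \<omega> in M. real_cond_exp M F (\<lambda>\<omega>. a \<omega> \<bullet> i) \<omega> = a \<omega> \<bullet> i"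
    using a by (intro real_cond_exp_F_meas) auto
  ultimately show "AE \<omega> in M. cond_expectation M F (\<lambda>\<omega>. y \<omega> + c *\<^sub>R (a \<omega> + (\<Sum>i\<in>Basis. (B i \<omega> \<bullet> y \<omega> + S i \<omega> \<bullet> z \<omega>) *\<^sub>R i))) \<omega> \<bullet> i
     = (cond_expectation M F y \<omega> + c *\<^sub>R (a \<omega> + (\<Sum>i\<in>Basis. (B i \<omega> \<bullet> cond_expectation M F y \<omega> + S i \<omega> \<bullet> cond_expectation M F z \<omega>) *\<^sub>R i))) \<bullet> i"
    unfolding inti cond_expectation_inner[OF i] by eventually_elim simp
qed

end

text \<open>\<open>Q\<close> is known only at the later stage \<open>G'\<close>, so it cannot be
  pulled out of the conditional expectation given \<open>G\<close>. It is pulled out given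
  \<open>G'\<close>, where \<open>V\<close> may be exchanged for \<open>W\<close>, and the tower
  property leads back to \<open>G\<close>.\<close>

lemma real_cond_exp_tower_mult:
  fixes V W Q :: "'a \<Rightarrow> real"
  assumes M: "finite_measure M" and G': "subalgebra M G'" and G: "subalgebra G' G"
    and eq: "AE \<omega> in M. real_cond_exp M G' V \<omega> = real_cond_exp M G' W \<omega>"
    and Q: "Q \<in> borel_measurable G'"
    and V: "V \<in> borel_measurable M" "integrable M (\<lambda>\<omega>. Q \<omega> * V \<omega>)"
    and W: "W \<in> borel_measurable M" "integrable M (\<lambda>\<omega>. Q \<omega> * W \<omega>)"
  shows "AE \<omega> in M. real_cond_exp M G (\<lambda>\<omega>. Q \<omega> * V \<omega>) \<omega> = real_cond_exp M G (\<lambda>\<omega>. Q \<omega> * W \<omega>) \<omega>"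
proof -
  have MG: "subalgebra M G" using G G' by (auto simp: subalgebra_def)
  interpret finite_measure M by fact
  interpret G: finite_measure_subalgebra M G by unfold_locales fact
  interpret G': finite_measure_subalgebra M G' by unfold_locales fact
  have "AE \<omega> in M. real_cond_exp M G' (\<lambda>\<omega>. Q \<omega> * V \<omega>) \<omega> = Q \<omega> * real_cond_exp M G' V \<omega>"
    by (intro G'.real_cond_exp_mult Q V)
  moreover have "AE \<omega> in M. real_cond_exp M G' (\<lambda>\<omega>. Q \<omega> * W \<omega>) \<omega> = Q \<omega> * real_cond_exp M G' W \<omega>"
    by (intro G'.real_cond_exp_mult Q W)
  ultimately have "AE \<omega> in M. real_cond_exp M G' (\<lambda>\<omega>. Q \<omega> * V \<omega>) \<omega> = real_cond_exp M G' (\<lambda>\<omega>. Q \<omega> * W \<omega>) \<omega>"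
    using eq by eventually_elim simp
  then have "AE \<omega> in M. real_cond_exp M G (real_cond_exp M G' (\<lambda>\<omega>. Q \<omega> * V \<omega>)) \<omega>
      = real_cond_exp M G (real_cond_exp M G' (\<lambda>\<omega>. Q \<omega> * W \<omega>)) \<omega>"
    by (intro G.real_cond_exp_cong) auto
  moreover have "AE \<omega> in M. real_cond_exp M G (real_cond_exp M G' (\<lambda>\<omega>. Q \<omega> * V \<omega>)) \<omega> = real_cond_exp M G (\<lambda>\<omega>. Q \<omega> * V \<omega>) \<omega>"
    by (intro G.real_cond_exp_nested_subalg G G' V)
  moreover have "AE \<omega> in M. real_cond_exp M G (real_cond_exp M G' (\<lambda>\<omega>. Q \<omega> * W \<omega>)) \<omega> = real_cond_exp M G (\<lambda>\<omega>. Q \<omega> * W \<omega>) \<omega>"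
    by (intro G.real_cond_exp_nested_subalg G G' W)
  ultimately show ?thesis by eventually_elim simp
qed

lemma Basis_matrix_cases:
  fixes e :: "real^'m^'d"
  assumes "e \<in> Basis"
  obtains i j where "e = axis i (axis j 1)" "\<And>A :: real^'m^'d. A \<bullet> e = A $ i $ j"
proof -
  obtain i b where b: "b \<in> Basis" "e = axis i b" using assms by (auto simp: Basis_vec_def)
  then obtain j where "b = axis j 1" by (auto simp: Basis_vec_def)
  then show ?thesis using b that[of i j] by (simp add: inner_axis)
qed

text \<open>One time step stripped of the model: \<open>G\<close> and \<open>G'\<close> stand for
  the information at two successive grid times, \<open>w\<close> for the increment, \<open>c\<close>
  for the step size and \<open>h\<close> for the mean-field term. Both recursions share the same
  \<open>h\<close>, so they differ only in the affine part and in where the conditional expectation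
  is taken.\<close>

lemma backward_step:
  fixes y ybar yn ybarn a h :: "'a \<Rightarrow> real^'d" and z zbar :: "'a \<Rightarrow> real^'m^'d" and w :: "'a \<Rightarrow> real^'m"
    and B :: "real^'d \<Rightarrow> 'a \<Rightarrow> real^'d" and S :: "real^'d \<Rightarrow> 'a \<Rightarrow> real^'m^'d"
  assumes M: "finite_measure M" and G': "subalgebra M G'" and G: "subalgebra G' G"
    and y: "moderate M y" and ybar: "moderate M ybar"
    and eq: "AE \<omega> in M. cond_expectation M G' ybar \<omega> = cond_expectation M G' y \<omega>"
    and w: "w \<in> borel_measurable G'" "\<And>j. has_all_moments M (\<lambda>\<omega>. w \<omega> $ j)"
    and a: "moderate M a" "a \<in> borel_measurable G" and h: "moderate M h" "h \<in> borel_measurable G"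
    and B: "\<And>i. i \<in> Basis \<Longrightarrow> B i \<in> borel_measurable G" "\<And>i \<omega>. i \<in> Basis \<Longrightarrow> \<omega> \<in> space M \<Longrightarrow> norm (B i \<omega>) \<le> C"
    and S: "\<And>i. i \<in> Basis \<Longrightarrow> S i \<in> borel_measurable G" "\<And>i \<omega>. i \<in> Basis \<Longrightarrow> \<omega> \<in> space M \<Longrightarrow> norm (S i \<omega>) \<le> C"
    and meas: "yn \<in> borel_measurable M" "ybarn \<in> borel_measurable M" "z \<in> borel_measurable M" "zbar \<in> borel_measurable M"
    and z: "AE \<omega> in M. z \<omega> = (1 / c) *\<^sub>R cond_expectation M G (\<lambda>\<omega>. outer_product (y \<omega>) (w \<omega>)) \<omega>"
    and zbar: "AE \<omega> in M. zbar \<omega> = (1 / c) *\<^sub>R outer_product (ybar \<omega>) (w \<omega>)"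
    and yn: "AE \<omega> in M. yn \<omega> = cond_expectation M G (\<lambda>\<omega>. y \<omega> + c *\<^sub>R (a \<omega> + (\<Sum>i\<in>Basis. (B i \<omega> \<bullet> y \<omega> + S i \<omega> \<bullet> z \<omega>) *\<^sub>R i))) \<omega> + c *\<^sub>R h \<omega>"
    and ybarn: "AE \<omega> in M. ybarn \<omega> = ybar \<omega> + c *\<^sub>R (a \<omega> + (\<Sum>i\<in>Basis. (B i \<omega> \<bullet> ybar \<omega> + S i \<omega> \<bullet> zbar \<omega>) *\<^sub>R i)) + c *\<^sub>R h \<omega>"
  shows "moderate M z" "moderate M zbar" "moderate M yn" "moderate M ybarn"
    "AE \<omega> in M. cond_expectation M G zbar \<omega> = z \<omega>"
    "AE \<omega> in M. cond_expectation M G ybarn \<omega> = yn \<omega>"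
proof -
  have MG: "subalgebra M G" using G G' by (auto simp: subalgebra_def)
  interpret finite_measure M by fact
  interpret G: finite_measure_subalgebra M G by unfold_locales fact
  interpret G': finite_measure_subalgebra M G' by unfold_locales fact
  \<comment> \<open>Each matrix entry is a component of \<open>v\<close> times a component of
    \<open>w\<close>, and the latter is a test factor.\<close>
  have outer: "moderate M (\<lambda>\<omega>. outer_product (v \<omega>) (w \<omega>))" if "moderate M v" for v :: "'a \<Rightarrow> real^'d"
  proof (rule moderate_componentwise)
    fix e :: "real^'m^'d" assume "e \<in> Basis"
    then obtain i j where "\<And>A :: real^'m^'d. A \<bullet> e = A $ i $ j" by (rule Basis_matrix_cases) blast
    moreover have "moderate M (\<lambda>\<omega>. w \<omega> $ j *\<^sub>R (v \<omega> $ i))"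
      by (intro moderate_scaleR w moderate_bounded_linear[OF bounded_linear_vec_nth] that)
    ultimately show "moderate M (\<lambda>\<omega>. outer_product (v \<omega>) (w \<omega>) \<bullet> e)"
      by (simp add: outer_product_def mult.commute)
  qed
  show zbar_mod: "moderate M zbar"
    by (intro moderate_AE_cong[OF zbar meas(4)] moderate_bounded_linear[OF bounded_linear_scaleR_right] outer ybar)
  show z_mod: "moderate M z"
    by (intro moderate_AE_cong[OF z meas(3)] moderate_bounded_linear[OF bounded_linear_scaleR_right]
        G.moderate_cond_expectation outer y)
  have int_y: "integrable M y" and int_ybar: "integrable M ybar" and int_z: "integrable M z"
    and int_zbar: "integrable M zbar" and int_a: "integrable M a" and int_h: "integrable M h"
    by (intro moderate_integrable y ybar z_mod zbar_mod a h)+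

  \<comment> \<open>The components of \<open>w\<close> are \<open>G'\<close>-measurable factors, so
    equality of the conditional expectations at the later time lets \<open>ybar\<close> be exchanged
    for \<open>y\<close> under the conditional expectation given \<open>G\<close>.\<close>
  have "AE \<omega> in M. cond_expectation M G (\<lambda>\<omega>. outer_product (ybar \<omega>) (w \<omega>)) \<omega>
      = cond_expectation M G (\<lambda>\<omega>. outer_product (y \<omega>) (w \<omega>)) \<omega>"
  proof (rule AE_eq_componentwise)
    fix e :: "real^'m^'d" assume e: "e \<in> Basis"
    then obtain i j where ij: "\<And>A :: real^'m^'d. A \<bullet> e = A $ i $ j" by (rule Basis_matrix_cases) blast
    have *: "v \<bullet> axis i 1 = v $ i" for v :: "real^'d" by (simp add: inner_axis)
    have int: "integrable M (\<lambda>\<omega>. w \<omega> $ j * v \<omega> $ i)" if "moderate M v" for v :: "'a \<Rightarrow> real^'d"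
      using moderate_integrable[OF moderate_scaleR[OF w(2) moderate_bounded_linear[OF bounded_linear_vec_nth that]]] by simp
    have "AE \<omega> in M. real_cond_exp M G (\<lambda>\<omega>. w \<omega> $ j * ybar \<omega> $ i) \<omega> = real_cond_exp M G (\<lambda>\<omega>. w \<omega> $ j * y \<omega> $ i) \<omega>"
    proof (rule real_cond_exp_tower_mult[OF M G' G])
      have "axis i 1 \<in> (Basis :: (real^'d) set)" by (simp add: axis_in_Basis_iff)
      note inner = cond_expectation_inner[OF this, unfolded *]
      show "AE \<omega> in M. real_cond_exp M G' (\<lambda>\<omega>. ybar \<omega> $ i) \<omega> = real_cond_exp M G' (\<lambda>\<omega>. y \<omega> $ i) \<omega>"
        using eq by eventually_elim (simp flip: inner)
    qed (use w int_y int_ybar int[OF y] int[OF ybar] in auto)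
    then show "AE \<omega> in M. cond_expectation M G (\<lambda>\<omega>. outer_product (ybar \<omega>) (w \<omega>)) \<omega> \<bullet> e
      = cond_expectation M G (\<lambda>\<omega>. outer_product (y \<omega>) (w \<omega>)) \<omega> \<bullet> e"
      unfolding cond_expectation_inner[OF e] unfolding ij by (simp add: outer_product_def mult.commute)
  qed
  moreover have "AE \<omega> in M. cond_expectation M G zbar \<omega> = cond_expectation M G (\<lambda>\<omega>. (1 / c) *\<^sub>R outer_product (ybar \<omega>) (w \<omega>)) \<omega>"
    using moderate_measurable[OF outer[OF ybar]] by (intro G.cond_expectation_cong_AE[OF zbar] meas) auto
  moreover have "AE \<omega> in M. cond_expectation M G (\<lambda>\<omega>. (1 / c) *\<^sub>R outer_product (ybar \<omega>) (w \<omega>)) \<omega>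
      = (1 / c) *\<^sub>R cond_expectation M G (\<lambda>\<omega>. outer_product (ybar \<omega>) (w \<omega>)) \<omega>"
    by (intro G.cond_expectation_scaleR moderate_integrable outer ybar)
  ultimately show Ezbar: "AE \<omega> in M. cond_expectation M G zbar \<omega> = z \<omega>"
    using z by eventually_elim simp

  \<comment> \<open>\<open>z\<close> is only almost everywhere equal to a
    \<open>G\<close>-measurable function, so its invariance is obtained through that
    version.\<close>
  have Ez: "AE \<omega> in M. cond_expectation M G z \<omega> = z \<omega>"
  proof -
    let ?z = "\<lambda>\<omega>. (1 / c) *\<^sub>R cond_expectation M G (\<lambda>\<omega>. outer_product (y \<omega>) (w \<omega>)) \<omega>"
    have "AE \<omega> in M. cond_expectation M G z \<omega> = cond_expectation M G ?z \<omega>"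
      by (intro G.cond_expectation_cong_AE[OF z] meas) auto
    moreover have "AE \<omega> in M. cond_expectation M G ?z \<omega> = ?z \<omega>"
      by (intro G.cond_expectation_F_meas integrable_scaleR_right G.integrable_cond_expectation moderate_integrable outer y) auto
    ultimately show ?thesis using z by eventually_elim simp
  qed

  have Ey: "AE \<omega> in M. cond_expectation M G ybar \<omega> = cond_expectation M G y \<omega>"
  proof (rule AE_eq_componentwise)
    fix i :: "real^'d" assume i: "i \<in> Basis"
    have "AE \<omega> in M. real_cond_exp M G' (\<lambda>\<omega>. ybar \<omega> \<bullet> i) \<omega> = real_cond_exp M G' (\<lambda>\<omega>. y \<omega> \<bullet> i) \<omega>"
      using eq by eventually_elim (simp flip: cond_expectation_inner[OF i])
    \<comment> \<open>The factor 1 turns the weighted statement into the plain tower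
      property.\<close>
    then have "AE \<omega> in M. real_cond_exp M G (\<lambda>\<omega>. 1 * (ybar \<omega> \<bullet> i)) \<omega> = real_cond_exp M G (\<lambda>\<omega>. 1 * (y \<omega> \<bullet> i)) \<omega>"
      by (rule real_cond_exp_tower_mult[OF M G' G]) (use int_y int_ybar in auto)
    then show "AE \<omega> in M. cond_expectation M G ybar \<omega> \<bullet> i = cond_expectation M G y \<omega> \<bullet> i"
      unfolding cond_expectation_inner[OF i] by simp
  qed

  \<comment> \<open>One affine map for both processes. Conditioning moves it onto the conditional
    expectations of its arguments, and these agree by \<open>Ey\<close>, \<open>Ez\<close> and
    \<open>Ezbar\<close>.\<close>
  define A where "A = (\<lambda>y z \<omega>. y \<omega> + c *\<^sub>R (a \<omega> + (\<Sum>i\<in>Basis. (B i \<omega> \<bullet> y \<omega> + S i \<omega> \<bullet> z \<omega>) *\<^sub>R i)))"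
  have A_mod: "moderate M (A y z)" if "moderate M y" "moderate M z" for y z
  proof -
    have Bk: "has_all_moments M (\<lambda>\<omega>. B i \<omega> \<bullet> k)" if "i \<in> Basis" "k \<in> Basis" for i k
      using B that measurable_from_subalg[OF MG B(1)]
      by (intro has_all_moments_bounded[where C = C]) (auto intro: order_trans[OF Basis_le_norm])
    have Sk: "has_all_moments M (\<lambda>\<omega>. S i \<omega> \<bullet> k)" if "i \<in> Basis" "k \<in> Basis" for i k
      using S that measurable_from_subalg[OF MG S(1)]
      by (intro has_all_moments_bounded[where C = C]) (auto intro: order_trans[OF Basis_le_norm])
    show ?thesis
      unfolding A_def
      by (intro moderate_add that moderate_bounded_linear[OF bounded_linear_scaleR_right] a moderate_sum
          moderate_bounded_linear[OF bounded_linear_scaleR_left] moderate_inner Bk Sk)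
  qed
  have ch: "moderate M (\<lambda>\<omega>. c *\<^sub>R h \<omega>)" by (intro moderate_bounded_linear[OF bounded_linear_scaleR_right] h)
  have yn': "AE \<omega> in M. yn \<omega> = cond_expectation M G (A y z) \<omega> + c *\<^sub>R h \<omega>"
    using yn unfolding A_def .
  have ybarn': "AE \<omega> in M. ybarn \<omega> = A ybar zbar \<omega> + c *\<^sub>R h \<omega>"
    using ybarn unfolding A_def .
  show "moderate M yn"
    by (intro moderate_AE_cong[OF yn' meas(1)] moderate_add ch G.moderate_cond_expectation A_mod y z_mod)
  show "moderate M ybarn"
    by (intro moderate_AE_cong[OF ybarn' meas(2)] moderate_add ch A_mod ybar zbar_mod)
  have "AE \<omega> in M. cond_expectation M G ybarn \<omega> = cond_expectation M G (\<lambda>\<omega>. A ybar zbar \<omega> + c *\<^sub>R h \<omega>) \<omega>"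
    by (intro G.cond_expectation_cong_AE[OF ybarn' meas(2)] moderate_measurable moderate_add A_mod ybar zbar_mod ch)
  moreover have "AE \<omega> in M. cond_expectation M G (\<lambda>\<omega>. A ybar zbar \<omega> + c *\<^sub>R h \<omega>) \<omega>
      = cond_expectation M G (A ybar zbar) \<omega> + cond_expectation M G (\<lambda>\<omega>. c *\<^sub>R h \<omega>) \<omega>"
    by (intro G.cond_expectation_add moderate_integrable A_mod ybar zbar_mod ch)
  moreover have "AE \<omega> in M. cond_expectation M G (\<lambda>\<omega>. c *\<^sub>R h \<omega>) \<omega> = c *\<^sub>R h \<omega>"
    using h by (intro G.cond_expectation_F_meas moderate_integrable ch) auto
  moreover have "AE \<omega> in M. cond_expectation M G (A ybar zbar) \<omega> = cond_expectation M G ybar \<omega> + c *\<^sub>R (a \<omega> +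
      (\<Sum>i\<in>Basis. (B i \<omega> \<bullet> cond_expectation M G ybar \<omega> + S i \<omega> \<bullet> cond_expectation M G zbar \<omega>) *\<^sub>R i))"
    unfolding A_def by (rule G.cond_expectation_affine[OF int_a a(2) int_ybar int_zbar B S])
  moreover have "AE \<omega> in M. cond_expectation M G (A y z) \<omega> = cond_expectation M G y \<omega> + c *\<^sub>R (a \<omega> +
      (\<Sum>i\<in>Basis. (B i \<omega> \<bullet> cond_expectation M G y \<omega> + S i \<omega> \<bullet> cond_expectation M G z \<omega>) *\<^sub>R i))"
    unfolding A_def by (rule G.cond_expectation_affine[OF int_a a(2) int_y int_z B S])
  ultimately show "AE \<omega> in M. cond_expectation M G ybarn \<omega> = yn \<omega>"
    using yn' Ey Ez Ezbar by eventually_elim simp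
qed

section \<open>Gaussian increments and square integrability\<close>

text \<open>The density of an increment is a product over coordinates, whereas Tonelli's theorem for
  \<open>lborel\<close> is phrased with products over \<open>Basis\<close>; this translates between
  the two.\<close>

lemma prod_Basis_vec: "(\<Prod>b\<in>(Basis :: (real^'m) set). f b) = (\<Prod>j\<in>UNIV. f (axis j 1))"
proof -
  have Basis: "(Basis :: (real^'m) set) = range (\<lambda>j. axis j 1)" by (auto simp: Basis_vec_def)
  have "inj (\<lambda>j::'m. axis j (1::real))" by (auto simp: inj_on_def axis_eq_axis)
  then show ?thesis unfolding Basis by (simp add: prod.reindex comp_def)
qed

text \<open>Under the product density a moment of one component factors into integrals over the
  line, all of which are finite Gaussian moments.\<close>

lemma has_all_moments_gaussian:
  fixes V :: "'a \<Rightarrow> real^'m"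
  assumes V: "distributed M lborel V (\<lambda>x. ennreal (\<Prod>j\<in>UNIV. normal_density 0 s (x $ j)))" and s: "s > 0"
  shows "has_all_moments M (\<lambda>\<omega>. V \<omega> $ j)"
  unfolding has_all_moments_def
proof (intro conjI allI)
  have [measurable]: "V \<in> borel_measurable M" using V by (simp add: distributed_def)
  then show "(\<lambda>\<omega>. V \<omega> $ j) \<in> borel_measurable M" by measurable
  fix k
  have "integrable lborel (\<lambda>x::real^'m. (\<Prod>j\<in>UNIV. normal_density 0 s (x $ j)) * (x $ j) ^ k)"
  proof (rule integrableI_bounded)
    \<comment> \<open>One factor per basis vector: the power sits at coordinate \<open>j\<close>
      alone, all other factors are bare densities.\<close>
    define g where "g = (\<lambda>(b::real^'m) x. normal_density 0 s x * (if b = axis j 1 then \<bar>x\<bar> ^ k else 1))"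
    have int: "integrable lborel (g b)" for b
      unfolding g_def using integrable_normal_moment_abs[OF s, of 0 k] integrable_normal_moment[OF s, of 0 0]
      by (cases "b = axis j 1") auto
    have "norm ((\<Prod>j\<in>UNIV. normal_density 0 s (x $ j)) * (x $ j) ^ k) = (\<Prod>b\<in>Basis. g b (x \<bullet> b))" for x :: "real^'m"
    proof -
      have "(\<Prod>b\<in>Basis. g b (x \<bullet> b)) = (\<Prod>i\<in>UNIV. normal_density 0 s (x $ i)) * (\<Prod>i\<in>UNIV. if i = j then \<bar>x $ i\<bar> ^ k else 1)"
        by (simp add: prod_Basis_vec g_def inner_axis axis_eq_axis prod.distrib)
      then show ?thesis
        by (simp add: prod.delta abs_mult power_abs abs_of_nonneg prod_nonneg)
    qed
    then have "(\<integral>\<^sup>+ x. ennreal (norm ((\<Prod>j\<in>UNIV. normal_density 0 s (x $ j)) * (x $ j) ^ k)) \<partial>(lborel :: (real^'m) measure))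
        = (\<integral>\<^sup>+ x. (\<Prod>b\<in>Basis. ennreal (g b (x \<bullet> b))) \<partial>lborel)"
      by (simp add: prod_ennreal g_def)
    also have "\<dots> = (\<Prod>b\<in>Basis. \<integral>\<^sup>+ x. ennreal (g b x) \<partial>lborel)"
      using int by (intro nn_integral_lborel_prod) (auto simp: g_def)
    also have "\<dots> < \<infinity>"
    proof -
      have "(\<integral>\<^sup>+ x. ennreal (g b x) \<partial>lborel) = ennreal (\<integral>x. g b x \<partial>lborel)" for b
        using int by (intro nn_integral_eq_integral) (auto simp: g_def)
      moreover have "0 \<le> (\<integral>x. g b x \<partial>lborel)" for b
        by (intro integral_nonneg_AE) (auto simp: g_def)
      ultimately show ?thesis by (simp add: prod_ennreal)
    qed
    finally show "(\<integral>\<^sup>+ x. ennreal (norm ((\<Prod>j\<in>UNIV. normal_density 0 s (x $ j)) * (x $ j) ^ k)) \<partial>(lborel :: (real^'m) measure)) < \<infinity>" .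
  qed measurable
  then show "integrable M (\<lambda>\<omega>. (V \<omega> $ j) ^ k)"
    by (subst (asm) distributed_integrable[OF V]) (auto simp: prod_nonneg)
qed

section \<open>Closure properties of \<open>L2\<close>\<close>

lemma L2_dominated:
  fixes V :: "'a \<Rightarrow> 'v::euclidean_space" and W :: "'a \<Rightarrow> 'w::euclidean_space"
  assumes [measurable]: "V \<in> borel_measurable M" and W: "W \<in> L2 M"
    and le: "AE \<omega> in M. norm (V \<omega>) \<le> norm (W \<omega>)"
  shows "V \<in> L2 M"
proof -
  have AE: "AE \<omega> in M. norm ((norm (V \<omega>))\<^sup>2) \<le> norm ((norm (W \<omega>))\<^sup>2)"
    using le by eventually_elim (auto intro: power_mono)
  have int: "integrable M (\<lambda>\<omega>. (norm (W \<omega>))\<^sup>2)" using W by (simp add: L2_def)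
  have "(\<lambda>\<omega>. (norm (V \<omega>))\<^sup>2) \<in> borel_measurable M" by measurable
  from Bochner_Integration.integrable_bound[OF int this AE] show ?thesis by (simp add: L2_def)
qed

lemma L2_add:
  fixes V W :: "'a \<Rightarrow> 'v::euclidean_space"
  assumes V: "V \<in> L2 M" and W: "W \<in> L2 M"
  shows "(\<lambda>\<omega>. V \<omega> + W \<omega>) \<in> L2 M"
proof -
  have [measurable]: "V \<in> borel_measurable M" "W \<in> borel_measurable M" using V W by (auto simp: L2_def)
  have int: "integrable M (\<lambda>\<omega>. 2 * (norm (V \<omega>))\<^sup>2 + 2 * (norm (W \<omega>))\<^sup>2)" using V W by (simp add: L2_def)
  have le: "(norm (V \<omega> + W \<omega>))\<^sup>2 \<le> 2 * (norm (V \<omega>))\<^sup>2 + 2 * (norm (W \<omega>))\<^sup>2" for \<omega>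
  proof -
    have "(norm (V \<omega> + W \<omega>))\<^sup>2 \<le> (norm (V \<omega>) + norm (W \<omega>))\<^sup>2" by (intro power_mono norm_triangle_ineq) auto
    also have "\<dots> \<le> 2 * (norm (V \<omega>))\<^sup>2 + 2 * (norm (W \<omega>))\<^sup>2"
      using sum_squares_bound[of "norm (V \<omega>)" "norm (W \<omega>)"] by (simp add: power2_sum)
    finally show ?thesis .
  qed
  have "integrable M (\<lambda>\<omega>. (norm (V \<omega> + W \<omega>))\<^sup>2)"
    by (rule Bochner_Integration.integrable_bound[OF int]) (auto intro!: AE_I2 le)
  then show ?thesis by (simp add: L2_def)
qed

lemma L2_scaleR:
  fixes V :: "'a \<Rightarrow> 'v::euclidean_space"
  shows "V \<in> L2 M \<Longrightarrow> (\<lambda>\<omega>. c *\<^sub>R V \<omega>) \<in> L2 M"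
  by (auto simp: L2_def power_mult_distrib)

lemma L2_norm_fun:
  fixes V :: "'a \<Rightarrow> 'v::euclidean_space"
  shows "V \<in> L2 M \<Longrightarrow> (\<lambda>\<omega>. norm (V \<omega>)) \<in> L2 M"
  by (auto simp: L2_def)

lemma (in finite_measure) L2_const:
  fixes c :: "'v::euclidean_space"
  shows "(\<lambda>\<omega>. c) \<in> L2 M"
  by (simp add: L2_def)

text \<open>There are two dominating variables, of possibly different types, since the coefficients
  grow in the state and in a second quantity that comes from the control. Here \<open>W2\<close> is
  a random variable and shadows the Wasserstein distance.\<close>

lemma (in finite_measure) L2_linear_growth:
  fixes V :: "'a \<Rightarrow> 'v::euclidean_space" and W1 :: "'a \<Rightarrow> 'w1::euclidean_space" and W2 :: "'a \<Rightarrow> 'w2::euclidean_space"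
  assumes V: "V \<in> borel_measurable M" and W: "W1 \<in> L2 M" "W2 \<in> L2 M"
    and le: "AE \<omega> in M. norm (V \<omega>) \<le> c + k * (norm (W1 \<omega>) + norm (W2 \<omega>))"
  shows "V \<in> L2 M"
proof (rule L2_dominated[OF V])
  show "(\<lambda>\<omega>. c + k *\<^sub>R (norm (W1 \<omega>) + norm (W2 \<omega>))) \<in> L2 M"
    by (intro L2_add L2_const L2_scaleR L2_norm_fun W)
  show "AE \<omega> in M. norm (V \<omega>) \<le> norm (c + k *\<^sub>R (norm (W1 \<omega>) + norm (W2 \<omega>)))"
    using le by eventually_elim simp
qed

lemma (in finite_measure) L2_integrable:
  fixes V :: "'a \<Rightarrow> 'v::euclidean_space"
  shows "V \<in> L2 M \<Longrightarrow> integrable M V"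
  by (intro moderate_integrable moderate_L2)

text \<open>Change of variables. It turns the assumption on the law of \<open>X 0\<close> into
  square integrability of \<open>X 0\<close>, and square integrability of \<open>X n\<close> into
  membership of \<open>\<mu> n\<close> in \<open>P2\<close>.\<close>

lemma (in prob_space) L2_iff_distr_in_P2:
  fixes V :: "'a \<Rightarrow> 'v::euclidean_space"
  assumes "V \<in> borel_measurable M"
  shows "V \<in> L2 M \<longleftrightarrow> distr M borel V \<in> P2"
  using assms by (auto simp: P2_def L2_def integrable_distr_eq intro: prob_space_distr)

lemma (in prob_space) distr_in_P2:
  fixes V :: "'a \<Rightarrow> 'v::euclidean_space"
  shows "V \<in> L2 M \<Longrightarrow> distr M borel V \<in> P2"
  using L2_iff_distr_in_P2[of V] by (simp add: L2_def)

text \<open>The norm on matrices is the Frobenius norm, so Cauchy-Schwarz row by row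
  suffices.\<close>

lemma norm_matrix_vector_mult_le:
  fixes A :: "real^'n^'m"
  shows "norm (A *v x) \<le> norm A * norm x"
proof -
  have "norm ((A *v x) $ i) \<le> norm (A $ i) * norm x" for i
    using Cauchy_Schwarz_ineq2[of "A $ i" x] by (simp add: matrix_vector_mul_component)
  then have "norm (A *v x) \<le> L2_set (\<lambda>i. norm (A $ i) * norm x) UNIV"
    unfolding norm_vec_def by (intro L2_set_mono) auto
  also have "\<dots> = norm A * norm x" by (simp add: norm_vec_def L2_set_left_distrib)
  finally show ?thesis .
qed

lemma bounded_bilinear_matrix_vector_mult: "bounded_bilinear ((*v) :: real^'n^'m \<Rightarrow> real^'n \<Rightarrow> real^'m)"
proof (rule bounded_bilinear.intro)
  show "\<exists>K. \<forall>(a :: real^'n^'m) b. norm (a *v b) \<le> norm a * norm b * K"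
    by (intro exI[of _ 1]) (simp add: norm_matrix_vector_mult_le)
qed (simp_all add: matrix_vector_mult_add_rdistrib matrix_vector_right_distrib flip: scaleR_matrix_vector_assoc matrix_vector_mult_scaleR)

lemma borel_measurable_matrix_vector_mult [measurable]:
  fixes A :: "'a \<Rightarrow> real^'n^'m"
  assumes "A \<in> borel_measurable M" "x \<in> borel_measurable M"
  shows "(\<lambda>\<omega>. A \<omega> *v x \<omega>) \<in> borel_measurable M"
  using assms
  by (rule borel_measurable_continuous_Pair)
    (intro bounded_bilinear.continuous_on[OF bounded_bilinear_matrix_vector_mult] continuous_intros)

text \<open>In general the product of two square-integrable factors is only integrable. Independence
  of |A|^2 and |w|^2, both integrable, makes their product integrable. This keeps the diffusion term
  of the forward scheme in \<open>L2\<close>.\<close>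

lemma (in prob_space) L2_matrix_vector_mult_indep:
  fixes A :: "'a \<Rightarrow> real^'n^'m"
  assumes G: "subalgebra M G" and A: "A \<in> borel_measurable G" "A \<in> L2 M" and w: "w \<in> L2 M"
    and indep: "indep_set (sets G) (sets (vimage_algebra (space M) w borel))"
  shows "(\<lambda>\<omega>. A \<omega> *v w \<omega>) \<in> L2 M"
proof -
  have [measurable]: "A \<in> borel_measurable M" "w \<in> borel_measurable M" "A \<in> borel_measurable G"
    using A w by (auto simp: L2_def)
  let ?a = "\<lambda>\<omega>. (norm (A \<omega>))\<^sup>2" and ?w = "\<lambda>\<omega>. (norm (w \<omega>))\<^sup>2"
  have "indep_set (sets G) (sets (vimage_algebra (space M) w borel))" by fact
  \<comment> \<open>Independence is inherited by the smaller \<sigma>-algebras generated by the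
    squared norms.\<close>
  moreover have "sigma_sets (space M) {?a -` B \<inter> space M |B. B \<in> sets borel} \<subseteq> sets G"
  proof -
    have "?a -` B \<inter> space M \<in> sets G" if "B \<in> sets borel" for B
    proof -
      have "?a \<in> borel_measurable G" by measurable
      from measurable_sets[OF this that] show ?thesis using G by (simp add: subalgebra_def)
    qed
    then have "{?a -` B \<inter> space M |B. B \<in> sets borel} \<subseteq> sets G" by blast
    from sets.sigma_sets_subset[OF this] show ?thesis using G by (simp add: subalgebra_def)
  qed
  moreover have "sigma_sets (space M) {?w -` B \<inter> space M |B. B \<in> sets borel} \<subseteq> sets (vimage_algebra (space M) w borel)"
  proof -
    have "w \<in> borel_measurable (vimage_algebra (space M) w borel)" by (rule measurable_vimage_algebra1) simp
    then have w2: "?w \<in> borel_measurable (vimage_algebra (space M) w borel)" by measurable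
    have "?w -` B \<inter> space M \<in> sets (vimage_algebra (space M) w borel)" if "B \<in> sets borel" for B
      using measurable_sets[OF w2 that] by simp
    then have "{?w -` B \<inter> space M |B. B \<in> sets borel} \<subseteq> sets (vimage_algebra (space M) w borel)" by blast
    from sets.sigma_sets_subset[OF this] show ?thesis by simp
  qed
  ultimately have "indep_var borel ?a borel ?w"
    unfolding indep_var_eq indep_sets2_eq
    by (intro conjI ballI) (measurable, blast+)
  then have "integrable M (\<lambda>\<omega>. ?a \<omega> * ?w \<omega>)"
    using A w by (intro indep_var_integrable) (auto simp: L2_def)
  then have "integrable M (\<lambda>\<omega>. (norm (A \<omega> *v w \<omega>))\<^sup>2)"
  proof (rule Bochner_Integration.integrable_bound)
    show "AE \<omega> in M. norm ((norm (A \<omega> *v w \<omega>))\<^sup>2) \<le> norm (?a \<omega> * ?w \<omega>)"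
      using power_mono[OF norm_matrix_vector_mult_le norm_ge_zero, of _ _ 2]
      by (auto simp: power_mult_distrib intro!: AE_I2)
  qed measurable
  then show ?thesis by (simp add: L2_def)
qed

section \<open>The gradient of the Hamiltonian and expectations over the copy\<close>

lemma trace_transpose_mult:
  fixes A B :: "real^'m^'d"
  shows "trace (transpose A ** B) = A \<bullet> B"
proof -
  have "trace (transpose A ** B) = (\<Sum>j\<in>UNIV. \<Sum>i\<in>UNIV. A $ i $ j * B $ i $ j)"
    by (simp add: trace_def matrix_matrix_mult_def transpose_def)
  also have "\<dots> = A \<bullet> B" by (subst sum.swap) (simp add: inner_vec_def)
  finally show ?thesis .
qed

lemma norm_transpose [simp]:
  fixes A :: "real^'m^'d"
  shows "norm (transpose A) = norm A"
proof -
  have "transpose A \<bullet> transpose A = (\<Sum>j\<in>UNIV. \<Sum>i\<in>UNIV. A $ i $ j * A $ i $ j)"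
    by (simp add: inner_vec_def transpose_def)
  also have "\<dots> = A \<bullet> A" by (subst sum.swap) (simp add: inner_vec_def)
  finally show ?thesis by (simp add: norm_eq_sqrt_inner)
qed

lemma borel_measurable_transpose [measurable]:
  fixes A :: "'a \<Rightarrow> real^'m^'d"
  assumes "A \<in> borel_measurable M"
  shows "(\<lambda>\<omega>. transpose (A \<omega>)) \<in> borel_measurable M"
  using assms
  by (rule measurable_compose)
    (auto simp: transpose_def intro!: borel_measurable_continuous_onI continuous_intros)

text \<open>\<open>grad\<close> is a definite description, so its evaluation rests on uniqueness of
  the Frechet derivative.\<close>

lemma grad_eqI:
  assumes "(h has_derivative (\<lambda>\<xi>. \<xi> \<bullet> D)) (at x)"
  shows "grad h x = D"
  unfolding grad_def gderiv_def
proof (rule the_equality)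
  show "(h has_derivative (\<lambda>\<xi>. \<xi> \<bullet> D)) (at x)" by (rule assms)
next
  fix D' assume "(h has_derivative (\<lambda>\<xi>. \<xi> \<bullet> D')) (at x)"
  then have "(\<lambda>\<xi>. \<xi> \<bullet> D') = (\<lambda>\<xi>. \<xi> \<bullet> D)" using assms by (rule has_derivative_unique)
  then show "D' = D" by (metis vector_eq_ldot)
qed

lemma grad_has_derivative:
  fixes h :: "'v::euclidean_space \<Rightarrow> real"
  assumes h: "(h has_derivative h') (at x)"
  shows "grad h x = (\<Sum>i\<in>Basis. h' i *\<^sub>R i)"
proof (rule grad_eqI)
  interpret h': bounded_linear h' using h by (rule has_derivative_bounded_linear)
  have "h' = (\<lambda>\<xi>. \<xi> \<bullet> (\<Sum>i\<in>Basis. h' i *\<^sub>R i))"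
  proof
    fix \<xi>
    have "h' \<xi> = h' (\<Sum>i\<in>Basis. (\<xi> \<bullet> i) *\<^sub>R i)" by (simp add: euclidean_representation)
    also have "\<dots> = (\<Sum>i\<in>Basis. (\<xi> \<bullet> i) * h' i)" by (simp add: h'.sum h'.scaleR)
    also have "\<dots> = \<xi> \<bullet> (\<Sum>i\<in>Basis. h' i *\<^sub>R i)" by (simp add: inner_sum_right mult.commute)
    finally show "h' \<xi> = \<xi> \<bullet> (\<Sum>i\<in>Basis. h' i *\<^sub>R i)" .
  qed
  then show "(h has_derivative (\<lambda>\<xi>. \<xi> \<bullet> (\<Sum>i\<in>Basis. h' i *\<^sub>R i))) (at x)" using h by simp
qed

text \<open>The trace term is the Frobenius inner product, so \<open>y\<close> and \<open>z\<close>
  enter H only through inner products. The gradient then takes exactly the affine form handled by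
  \<open>cond_expectation_affine\<close>.\<close>

lemma grad_x_hamiltonian_eq:
  assumes f: "((\<lambda>x'. f t x' \<mu> u) has_derivative Df) (at x)"
    and b: "((\<lambda>x'. b t x' \<mu> u) has_derivative Db) (at x)"
    and \<sigma>: "((\<lambda>x'. \<sigma> t x' u) has_derivative Ds) (at x)"
  shows "grad_x_hamiltonian b \<sigma> f t x \<mu> y z u
    = (\<Sum>i\<in>Basis. Df i *\<^sub>R i) + (\<Sum>i\<in>Basis. (Db i \<bullet> y + Ds i \<bullet> z) *\<^sub>R i)"
proof -
  have "((\<lambda>x'. hamiltonian b \<sigma> f t x' \<mu> y z u) has_derivative (\<lambda>\<xi>. Df \<xi> + Db \<xi> \<bullet> y + Ds \<xi> \<bullet> z)) (at x)"
    unfolding hamiltonian_def trace_transpose_mult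
    by (intro has_derivative_add has_derivative_inner_left f b \<sigma>)
  from grad_has_derivative[OF this] show ?thesis
    unfolding grad_x_hamiltonian_def by (simp add: sum.distrib scaleR_left_distrib)
qed

text \<open>For \<open>u\<close> in \<open>U\<close> the whole slice of points
  \<open>(x', u)\<close> lies in \<open>UNIV \<times> U\<close>. Hence the derivative in
  \<open>x\<close> is an unrestricted one, even when \<open>U\<close> has empty interior.\<close>

lemma C1_in_xu_has_derivative:
  assumes C1: "C1_in_xu U h Dx Du" and \<mu>: "\<mu> \<in> P2" and u: "u \<in> U"
  shows "((\<lambda>x'. h x' \<mu> u) has_derivative blinfun_apply (Dx x \<mu> u)) (at x)"
proof -
  have "((\<lambda>(x', u'). h x' \<mu> u') has_derivative
        (\<lambda>(\<xi>, \<eta>). blinfun_apply (Dx x \<mu> u) \<xi> + blinfun_apply (Du x \<mu> u) \<eta>)) (at (x, u) within UNIV \<times> U)"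
    using C1 \<mu> u by (auto simp: C1_in_xu_def)
  then have h: "((\<lambda>(x', u'). h x' \<mu> u') has_derivative
        (\<lambda>(\<xi>, \<eta>). blinfun_apply (Dx x \<mu> u) \<xi> + blinfun_apply (Du x \<mu> u) \<eta>)) (at (x, u) within (\<lambda>x'. (x', u)) ` UNIV)"
    by (rule has_derivative_subset) (use u in auto)
  have "((\<lambda>x'. (x', u)) has_derivative (\<lambda>\<xi>. (\<xi>, 0))) (at x)"
    by (intro derivative_intros)
  from has_derivative_in_compose[OF this h] show ?thesis by (simp add: blinfun.zero_right)
qed

text \<open>The laws along the scheme are deterministic. Freezing such a law turns continuity in the
  Wasserstein topology into ordinary continuity on a Euclidean set, which is what measurability of
  the compositions rests on.\<close>

lemma continuous_on_slice_xu:
  assumes "continuous_map (prod_topology euclidean (prod_topology W2_topology (top_of_set U))) euclidean (\<lambda>(x, \<mu>, u). D x \<mu> u)"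
    and "\<mu> \<in> P2"
  shows "continuous_on (UNIV \<times> U) (\<lambda>(x, u). D x \<mu> u)"
proof -
  have "continuous_map (top_of_set (UNIV \<times> U)) (prod_topology euclidean (prod_topology W2_topology (top_of_set U))) (\<lambda>(x, u). (x, \<mu>, u))"
    using assms(2)
    by (auto simp: continuous_map_pairwise topspace_W2_topology o_def case_prod_unfold
        continuous_map_in_subtopology intro!: continuous_intros)
  from continuous_map_compose[OF this assms(1)] show ?thesis
    by (simp add: o_def case_prod_unfold)
qed

lemma continuous_on_slice_xuv:
  assumes "continuous_map (prod_topology euclidean (prod_topology W2_topology (prod_topology (top_of_set U) euclidean))) euclidean
      (\<lambda>(x, \<mu>, u, v). D x \<mu> u v)"
    and "\<mu> \<in> P2"
  shows "continuous_on (UNIV \<times> U \<times> UNIV) (\<lambda>(x, u, v). D x \<mu> u v)"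
proof -
  have "continuous_map (top_of_set (UNIV \<times> U \<times> UNIV)) (prod_topology euclidean (prod_topology W2_topology (prod_topology (top_of_set U) euclidean)))
     (\<lambda>(x, u, v). (x, \<mu>, u, v))"
    using assms(2)
    by (auto simp: continuous_map_pairwise topspace_W2_topology o_def case_prod_unfold
        continuous_map_in_subtopology intro!: continuous_intros)
  from continuous_map_compose[OF this assms(1)] show ?thesis
    by (simp add: o_def case_prod_unfold)
qed

lemma measurable_compose_continuous_on:
  assumes k: "continuous_on S k" and V: "V \<in> borel_measurable M" "\<And>\<omega>. \<omega> \<in> space M \<Longrightarrow> V \<omega> \<in> S"
  shows "(\<lambda>\<omega>. k (V \<omega>)) \<in> borel_measurable M"
proof -
  have "V \<in> measurable M (restrict_space borel S)" using V by (intro measurable_restrict_space2) auto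
  from measurable_compose[OF this borel_measurable_continuous_on_restrict[OF k]] show ?thesis .
qed

lemma space_P2_borel: "space (P2_borel :: 'v::euclidean_space measure measure) = P2"
proof -
  have "{S. openin W2_topology S} \<subseteq> Pow (P2 :: 'v measure set)"
    by (auto simp: openin_W2_topology W2_open_def)
  then show ?thesis unfolding P2_borel_def by (rule space_measure_of)
qed

text \<open>The control set \<open>U\<close> need not be Borel, so integrands continuous in \<open>u \<in> U\<close> are measurable only
  for the trace \<open>\<sigma>\<close>-algebra, and equality of laws has to be carried over to it.\<close>

lemma distr_restrict_space_eqI:
  assumes V: "V \<in> borel_measurable M" "\<And>\<omega>. \<omega> \<in> space M \<Longrightarrow> V \<omega> \<in> S"
    and V': "V' \<in> borel_measurable M'" "\<And>\<omega>. \<omega> \<in> space M' \<Longrightarrow> V' \<omega> \<in> S"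
    and eq: "distr M borel V = distr M' borel V'"
  shows "distr M (restrict_space borel S) V = distr M' (restrict_space borel S) V'"
proof (rule measure_eqI)
  have VS: "V \<in> measurable M (restrict_space borel S)" "V' \<in> measurable M' (restrict_space borel S)"
    using V V' by (auto intro!: measurable_restrict_space2)
  fix A assume "A \<in> sets (distr M (restrict_space borel S) V)"
  then have A: "A \<in> sets (restrict_space borel S)" by simp
  then obtain B where B: "B \<in> sets borel" "A = S \<inter> B" by (auto simp: sets_restrict_space)
  have "V -` A \<inter> space M = V -` B \<inter> space M" "V' -` A \<inter> space M' = V' -` B \<inter> space M'"
    using V(2) V'(2) B(2) by auto
  then have "emeasure (distr M (restrict_space borel S) V) A = emeasure (distr M borel V) B"
    "emeasure (distr M' (restrict_space borel S) V') A = emeasure (distr M' borel V') B"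
    using VS V(1) V'(1) A B(1) by (simp_all add: emeasure_distr)
  then show "emeasure (distr M (restrict_space borel S) V) A = emeasure (distr M' (restrict_space borel S) V') A"
    using eq by simp
qed simp

text \<open>\<open>k\<close> is continuous on \<open>S\<close> only, so both laws are restricted to
  the trace \<sigma>-algebra of \<open>S\<close> before the change of variables.\<close>

lemma integral_eq_if_distr_eq:
  fixes k :: "'v::topological_space \<Rightarrow> 'e::{banach, second_countable_topology}"
  assumes V: "V \<in> borel_measurable M" "\<And>\<omega>. \<omega> \<in> space M \<Longrightarrow> V \<omega> \<in> S"
    and V': "V' \<in> borel_measurable M'" "\<And>\<omega>. \<omega> \<in> space M' \<Longrightarrow> V' \<omega> \<in> S"
    and eq: "distr M borel V = distr M' borel V'"
    and k: "continuous_on S k"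
  shows "(\<integral>\<omega>. k (V \<omega>) \<partial>M) = (\<integral>\<omega>. k (V' \<omega>) \<partial>M')"
proof -
  have "V \<in> measurable M (restrict_space borel S)" "V' \<in> measurable M' (restrict_space borel S)"
    using V V' by (auto intro!: measurable_restrict_space2)
  then show ?thesis
    using distr_restrict_space_eqI[OF V V' eq] borel_measurable_continuous_on_restrict[OF k]
    by (simp flip: integral_distr)
qed

lemma copy_of_family_distr:
  assumes copy: "copy_of_family M' V' M V I" and p: "p \<in> borel_measurable (\<Pi>\<^sub>M i\<in>I. borel)"
  shows "distr M' borel (\<lambda>\<omega>. p (\<lambda>i\<in>I. V' i \<omega>)) = distr M borel (\<lambda>\<omega>. p (\<lambda>i\<in>I. V i \<omega>))"
proof -
  have "(\<lambda>\<omega>. \<lambda>i\<in>I. V' i \<omega>) \<in> measurable M' (\<Pi>\<^sub>M i\<in>I. borel)" "(\<lambda>\<omega>. \<lambda>i\<in>I. V i \<omega>) \<in> measurable M (\<Pi>\<^sub>M i\<in>I. borel)"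
    using copy by (auto simp: copy_of_family_def intro!: measurable_restrict)
  note * = distr_distr[OF p this(1), unfolded comp_def] distr_distr[OF p this(2), unfolded comp_def]
  have "distr M' (\<Pi>\<^sub>M i\<in>I. borel) (\<lambda>\<omega>. \<lambda>i\<in>I. V' i \<omega>) = distr M (\<Pi>\<^sub>M i\<in>I. borel) (\<lambda>\<omega>. \<lambda>i\<in>I. V i \<omega>)"
    using copy by (simp only: copy_of_family_def)
  then show ?thesis unfolding *[symmetric] by (rule arg_cong)
qed

lemma (in finite_measure) integrable_bounded_inner:
  fixes B V :: "'a \<Rightarrow> 'v::euclidean_space"
  assumes [measurable]: "B \<in> borel_measurable M" and V: "integrable M V"
    and le: "\<And>\<omega>. \<omega> \<in> space M \<Longrightarrow> norm (B \<omega>) \<le> C"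
  shows "integrable M (\<lambda>\<omega>. B \<omega> \<bullet> V \<omega>)"
proof (rule Bochner_Integration.integrable_bound)
  show "integrable M (\<lambda>\<omega>. C * norm (V \<omega>))" using V by auto
  show "AE \<omega> in M. norm (B \<omega> \<bullet> V \<omega>) \<le> norm (C * norm (V \<omega>))"
    by (auto intro!: AE_I2 order_trans[OF Cauchy_Schwarz_ineq2] order_trans[OF mult_right_mono[OF le] abs_ge_self])
qed (use V in measurable)

text \<open>Counterpart of the tower argument for full expectations: a bounded
  \<open>G\<close>-measurable factor cannot tell apart two variables with the same conditional
  expectation.\<close>

lemma integral_inner_cond_expectation_cong:
  fixes B V W :: "'a \<Rightarrow> 'v::euclidean_space"
  assumes M: "finite_measure M" and G: "subalgebra M G" and B: "B \<in> borel_measurable G"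
    and le: "\<And>\<omega>. \<omega> \<in> space M \<Longrightarrow> norm (B \<omega>) \<le> C"
    and V: "integrable M V" and W: "integrable M W"
    and eq: "AE \<omega> in M. cond_expectation M G V \<omega> = cond_expectation M G W \<omega>"
  shows "(\<integral>\<omega>. B \<omega> \<bullet> V \<omega> \<partial>M) = (\<integral>\<omega>. B \<omega> \<bullet> W \<omega> \<partial>M)"
proof -
  interpret finite_measure M by fact
  interpret G: finite_measure_subalgebra M G by unfold_locales fact
  have [measurable]: "B \<in> borel_measurable M" using measurable_from_subalg[OF G B] .
  have [measurable]: "cond_expectation M G V \<in> borel_measurable M" for V :: "'a \<Rightarrow> 'v" by measurable
  have *: "(\<integral>\<omega>. B \<omega> \<bullet> V \<omega> \<partial>M) = (\<integral>\<omega>. B \<omega> \<bullet> cond_expectation M G V \<omega> \<partial>M)"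
    if V: "integrable M V" for V
  proof -
    have int: "integrable M (\<lambda>\<omega>. (B \<omega> \<bullet> i) * (V \<omega> \<bullet> i))" if "i \<in> Basis" for i
    proof -
      have "integrable M (\<lambda>\<omega>. (B \<omega> \<bullet> i) \<bullet> (V \<omega> \<bullet> i))"
      proof (rule integrable_bounded_inner)
        show "norm (B \<omega> \<bullet> i) \<le> C" if "\<omega> \<in> space M" for \<omega>
          using Basis_le_norm[OF \<open>i \<in> Basis\<close>, of "B \<omega>"] le[OF that] by simp
        show "(\<lambda>\<omega>. B \<omega> \<bullet> i) \<in> borel_measurable M" by measurable
        show "integrable M (\<lambda>\<omega>. V \<omega> \<bullet> i)" using V by (rule integrable_inner_left)
      qed
      then show ?thesis by simp
    qed
    have "(\<integral>\<omega>. B \<omega> \<bullet> V \<omega> \<partial>M) = (\<integral>\<omega>. real_cond_exp M G (\<lambda>\<omega>. B \<omega> \<bullet> V \<omega>) \<omega> \<partial>M)"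
      by (rule G.real_cond_exp_int(2)[symmetric, OF integrable_bounded_inner[OF \<open>B \<in> borel_measurable M\<close> V le]])
    also have "\<dots> = (\<integral>\<omega>. B \<omega> \<bullet> cond_expectation M G V \<omega> \<partial>M)"
    proof (rule integral_cong_AE)
      show "AE \<omega> in M. real_cond_exp M G (\<lambda>\<omega>. B \<omega> \<bullet> V \<omega>) \<omega> = B \<omega> \<bullet> cond_expectation M G V \<omega>"
        by (rule G.real_cond_exp_inner[OF B V int])
    qed measurable
    finally show ?thesis .
  qed
  have "(\<integral>\<omega>. B \<omega> \<bullet> cond_expectation M G V \<omega> \<partial>M) = (\<integral>\<omega>. B \<omega> \<bullet> cond_expectation M G W \<omega> \<partial>M)"
  proof (rule integral_cong_AE)
    show "AE \<omega> in M. B \<omega> \<bullet> cond_expectation M G V \<omega> = B \<omega> \<bullet> cond_expectation M G W \<omega>"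
      using eq by eventually_elim simp
  qed measurable
  then show ?thesis using *[OF V] *[OF W] by simp
qed

lemma measurable_data_compose:
  assumes F: "(\<lambda>(t, x, \<mu>, u). F t x \<mu> u) \<in> borel_measurable
      (restrict_space borel {0..T} \<Otimes>\<^sub>M borel \<Otimes>\<^sub>M P2_borel \<Otimes>\<^sub>M restrict_space borel U)"
    and t: "t \<in> {0..T}" and \<mu>: "\<mu> \<in> P2"
    and X: "X \<in> borel_measurable G" and u: "u \<in> measurable G (restrict_space borel U)"
  shows "(\<lambda>\<omega>. F t (X \<omega>) \<mu> (u \<omega>)) \<in> borel_measurable G"
proof -
  have "(\<lambda>\<omega>. (t, X \<omega>, \<mu>, u \<omega>)) \<in> measurable G
      (restrict_space borel {0..T} \<Otimes>\<^sub>M borel \<Otimes>\<^sub>M P2_borel \<Otimes>\<^sub>M restrict_space borel U)"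
    using t \<mu> by (intro measurable_Pair X u measurable_const) (auto simp: space_P2_borel space_restrict_space)
  from measurable_compose[OF this F] show ?thesis by simp
qed

lemma L2_if_has_all_moments:
  fixes w :: "'a \<Rightarrow> real^'m"
  assumes w: "w \<in> borel_measurable M" "\<And>j. has_all_moments M (\<lambda>\<omega>. w \<omega> $ j)"
  shows "w \<in> L2 M"
proof -
  have "(norm (w \<omega>))\<^sup>2 = (\<Sum>j\<in>UNIV. (w \<omega> $ j)\<^sup>2)" for \<omega>
    by (simp add: norm_vec_def L2_set_def sum_nonneg)
  moreover have "integrable M (\<lambda>\<omega>. (w \<omega> $ j)\<^sup>2)" for j
    using w(2)[of j] by (simp add: has_all_moments_def)
  ultimately show ?thesis using w(1) by (simp add: L2_def)
qed

lemma borel_measurable_component_compose: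
  assumes "i \<in> I" "continuous_on UNIV s"
  shows "(\<lambda>v. s (v i)) \<in> borel_measurable (\<Pi>\<^sub>M i\<in>I. borel)"
  by (rule measurable_compose[OF measurable_component_singleton[OF assms(1), where M = "\<lambda>_. borel"]
      borel_measurable_continuous_onI[OF assms(2)]])

text \<open>The integrand couples state and control at \<open>n\<close> with an adjoint value at
  \<open>Suc n\<close>. Equality of the laws at single times would not be enough, so the law of the
  whole family is used.\<close>

lemma copy_of_family_integral_eq:
  fixes Xh Yh Ybarh :: "nat \<Rightarrow> 'b \<Rightarrow> real^'d" and uh :: "nat \<Rightarrow> 'b \<Rightarrow> real^'c"
    and X Y Ybar :: "nat \<Rightarrow> 'a \<Rightarrow> real^'d" and u :: "nat \<Rightarrow> 'a \<Rightarrow> real^'c"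
    and k :: "(real^'d) \<times> (real^'c) \<times> (real^'d) \<Rightarrow> real^'d"
  assumes copy: "copy_of_family M' (\<lambda>n \<omega>. (Xh n \<omega>, uh n \<omega>, Yh n \<omega>, Ybarh n \<omega>))
                              M (\<lambda>n \<omega>. (X n \<omega>, u n \<omega>, Y n \<omega>, Ybar n \<omega>)) {..N}"
    and n: "n < N"
    and U: "\<And>\<omega>. \<omega> \<in> space M \<Longrightarrow> u n \<omega> \<in> U" "\<And>\<omega>. \<omega> \<in> space M' \<Longrightarrow> uh n \<omega> \<in> U"
    and k: "continuous_on (UNIV \<times> U \<times> UNIV) k"
  shows "(\<integral>\<omega>. k (Xh n \<omega>, uh n \<omega>, Yh (Suc n) \<omega>) \<partial>M') = (\<integral>\<omega>. k (X n \<omega>, u n \<omega>, Y (Suc n) \<omega>) \<partial>M)"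
    and "(\<integral>\<omega>. k (Xh n \<omega>, uh n \<omega>, Ybarh (Suc n) \<omega>) \<partial>M') = (\<integral>\<omega>. k (X n \<omega>, u n \<omega>, Ybar (Suc n) \<omega>) \<partial>M)"
proof -
  have *: "(\<integral>\<omega>. k (Xh n \<omega>, uh n \<omega>, r (Xh (Suc n) \<omega>, uh (Suc n) \<omega>, Yh (Suc n) \<omega>, Ybarh (Suc n) \<omega>)) \<partial>M')
      = (\<integral>\<omega>. k (X n \<omega>, u n \<omega>, r (X (Suc n) \<omega>, u (Suc n) \<omega>, Y (Suc n) \<omega>, Ybar (Suc n) \<omega>)) \<partial>M)"
    if r: "continuous_on UNIV r" for r :: "(real^'d) \<times> (real^'c) \<times> (real^'d) \<times> (real^'d) \<Rightarrow> real^'d"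
  proof -
    \<comment> \<open>\<open>r\<close> selects the \<open>Y\<close> or the \<open>Ybar\<close>
      component at the later time; \<open>n < N\<close> puts both indices into
      \<open>{..N}\<close>.\<close>
    define p where "p = (\<lambda>v :: nat \<Rightarrow> (real^'d) \<times> (real^'c) \<times> (real^'d) \<times> (real^'d).
      (fst (v n), fst (snd (v n)), r (v (Suc n))))"
    have p: "p \<in> borel_measurable (\<Pi>\<^sub>M i\<in>{..N}. borel)"
      unfolding p_def using n
      by (intro borel_measurable_Pair borel_measurable_component_compose[where s = "\<lambda>v. fst v"]
          borel_measurable_component_compose[where s = "\<lambda>v. fst (snd v)"] borel_measurable_component_compose[where s = r] r)
        (auto intro!: continuous_intros)
    from copy_of_family_distr[OF copy p] n
    have eq: "distr M' borel (\<lambda>\<omega>. (Xh n \<omega>, uh n \<omega>, r (Xh (Suc n) \<omega>, uh (Suc n) \<omega>, Yh (Suc n) \<omega>, Ybarh (Suc n) \<omega>)))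
      = distr M borel (\<lambda>\<omega>. (X n \<omega>, u n \<omega>, r (X (Suc n) \<omega>, u (Suc n) \<omega>, Y (Suc n) \<omega>, Ybar (Suc n) \<omega>)))"
      by (simp add: p_def)
    have restr: "(\<lambda>\<omega>. \<lambda>i\<in>{..N}. (Xh i \<omega>, uh i \<omega>, Yh i \<omega>, Ybarh i \<omega>)) \<in> measurable M' (\<Pi>\<^sub>M i\<in>{..N}. borel)"
       "(\<lambda>\<omega>. \<lambda>i\<in>{..N}. (X i \<omega>, u i \<omega>, Y i \<omega>, Ybar i \<omega>)) \<in> measurable M (\<Pi>\<^sub>M i\<in>{..N}. borel)"
      using copy by (auto simp: copy_of_family_def intro!: measurable_restrict)
    show ?thesis
      by (rule integral_eq_if_distr_eq[OF _ _ _ _ eq k])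
        (use measurable_compose[OF restr(1) p] measurable_compose[OF restr(2) p] U n in \<open>auto simp: p_def\<close>)
  qed
  have "continuous_on UNIV (\<lambda>z. fst (snd (snd z)))" "continuous_on UNIV (\<lambda>z. snd (snd (snd z)))"
    by (intro continuous_intros)+
  from *[OF this(1)] *[OF this(2)]
  show "(\<integral>\<omega>. k (Xh n \<omega>, uh n \<omega>, Yh (Suc n) \<omega>) \<partial>M') = (\<integral>\<omega>. k (X n \<omega>, u n \<omega>, Y (Suc n) \<omega>) \<partial>M)"
    and "(\<integral>\<omega>. k (Xh n \<omega>, uh n \<omega>, Ybarh (Suc n) \<omega>) \<partial>M') = (\<integral>\<omega>. k (X n \<omega>, u n \<omega>, Ybar (Suc n) \<omega>) \<partial>M)"
    by simp_all
qed

text \<open>Once the copy is rewritten over \<open>M\<close> and the outer state is frozen at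
  \<open>x\<close>, only \<open>V\<close> distinguishes the two recursions. The matrix is bounded
  and \<open>G\<close>-measurable, so equal conditional expectations given \<open>G\<close> force
  equal integrals. Measurability and linear growth in \<open>x\<close> are recorded because a random
  state is substituted for \<open>x\<close> afterwards.\<close>

lemma mean_field_term:
  fixes A :: "real^'d \<Rightarrow> real^'c \<Rightarrow> real^'d \<Rightarrow> real^'d^'d" and D :: "real^'d \<Rightarrow> real^'c \<Rightarrow> real^'d \<Rightarrow> real^'d"
    and X Y Ybar :: "'a \<Rightarrow> real^'d" and u :: "'a \<Rightarrow> real^'c"
  assumes M: "prob_space M" and G: "subalgebra M G"
    and A: "continuous_on (UNIV \<times> U \<times> UNIV) (\<lambda>(x, u, v). A x u v)"
      "\<And>x u v. u \<in> U \<Longrightarrow> norm (A x u v) \<le> C"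
    and D: "continuous_on (UNIV \<times> U \<times> UNIV) (\<lambda>(x, u, v). D x u v)"
      "\<And>x u v. u \<in> U \<Longrightarrow> norm (D x u v) \<le> K * (1 + norm x + norm u + norm v + m)"
    and X: "X \<in> borel_measurable G" "X \<in> L2 M" and u: "u \<in> borel_measurable G" "u \<in> L2 M"
      "\<And>\<omega>. \<omega> \<in> space M \<Longrightarrow> u \<omega> \<in> U"
    and Y: "integrable M Y" and Ybar: "integrable M Ybar"
    and eq: "AE \<omega> in M. cond_expectation M G Ybar \<omega> = cond_expectation M G Y \<omega>"
  defines "h \<equiv> \<lambda>V x. \<integral>\<omega>. transpose (A (X \<omega>) (u \<omega>) x) *v V \<omega> + D (X \<omega>) (u \<omega>) x \<partial>M"
  shows "h Ybar = h Y" "h Y \<in> borel_measurable borel" "\<exists>a b. \<forall>x. norm (h Y x) \<le> a + b * norm x"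
proof -
  interpret prob_space M by fact
  have [measurable]: "X \<in> borel_measurable M" "u \<in> borel_measurable M" "Y \<in> borel_measurable M"
    using X u Y by (auto simp: L2_def)
  have AG: "(\<lambda>\<omega>. A (X \<omega>) (u \<omega>) x) \<in> borel_measurable G" for x
  proof -
    have "(\<lambda>\<omega>. (\<lambda>(x, u, v). A x u v) (X \<omega>, u \<omega>, x)) \<in> borel_measurable G"
      using X u G by (intro measurable_compose_continuous_on[OF A(1)] borel_measurable_Pair) (auto simp: subalgebra_def)
    then show ?thesis by simp
  qed
  have [measurable]: "(\<lambda>\<omega>. A (X \<omega>) (u \<omega>) x) \<in> borel_measurable M" for x
    using measurable_from_subalg[OF G AG] .
  have [measurable]: "(\<lambda>\<omega>. D (X \<omega>) (u \<omega>) x) \<in> borel_measurable M" for x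
  proof -
    have "(\<lambda>\<omega>. (\<lambda>(x, u, v). D x u v) (X \<omega>, u \<omega>, x)) \<in> borel_measurable M"
      using u by (intro measurable_compose_continuous_on[OF D(1)] borel_measurable_Pair) auto
    then show ?thesis by simp
  qed
  have normX: "integrable M (\<lambda>\<omega>. norm (X \<omega>))" and normu: "integrable M (\<lambda>\<omega>. norm (u \<omega>))"
    using L2_integrable[OF X(2)] L2_integrable[OF u(2)] by auto
  have Dle: "norm (D (X \<omega>) (u \<omega>) x) \<le> \<bar>K\<bar> * (1 + norm (X \<omega>) + norm (u \<omega>) + norm x + \<bar>m\<bar>)" if "\<omega> \<in> space M" for \<omega> x
  proof -
    have "norm (D (X \<omega>) (u \<omega>) x) \<le> \<bar>K * (1 + norm (X \<omega>) + norm (u \<omega>) + norm x + m)\<bar>"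
      using D(2)[OF u(3)[OF that], of "X \<omega>" x] by linarith
    also have "\<dots> \<le> \<bar>K\<bar> * (1 + norm (X \<omega>) + norm (u \<omega>) + norm x + \<bar>m\<bar>)"
      unfolding abs_mult using norm_ge_zero[of "X \<omega>"] norm_ge_zero[of "u \<omega>"] norm_ge_zero[of x]
      by (intro mult_left_mono abs_ge_zero) linarith
    finally show ?thesis .
  qed
  have intD: "integrable M (\<lambda>\<omega>. D (X \<omega>) (u \<omega>) x)" for x
  proof (rule Bochner_Integration.integrable_bound)
    show "integrable M (\<lambda>\<omega>. \<bar>K\<bar> * (1 + norm (X \<omega>) + norm (u \<omega>) + norm x + \<bar>m\<bar>))"
      using normX normu by auto
    show "AE \<omega> in M. norm (D (X \<omega>) (u \<omega>) x) \<le> norm (\<bar>K\<bar> * (1 + norm (X \<omega>) + norm (u \<omega>) + norm x + \<bar>m\<bar>))"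
      by (intro AE_I2 order_trans[OF Dle]) (auto simp: abs_mult)
  qed measurable
  have Ale: "norm (transpose (A (X \<omega>) (u \<omega>) x) *v V \<omega>) \<le> C * norm (V \<omega>)" if "\<omega> \<in> space M" for \<omega> x and V :: "'a \<Rightarrow> real^'d"
    using A(2)[OF u(3)[OF that], of "X \<omega>" x]
    by (intro order_trans[OF norm_matrix_vector_mult_le] mult_right_mono) auto
  have intA: "integrable M (\<lambda>\<omega>. transpose (A (X \<omega>) (u \<omega>) x) *v V \<omega>)" if V: "integrable M V" for x and V
  proof (rule Bochner_Integration.integrable_bound)
    show "integrable M (\<lambda>\<omega>. C * norm (V \<omega>))" using V by auto
    show "AE \<omega> in M. norm (transpose (A (X \<omega>) (u \<omega>) x) *v V \<omega>) \<le> norm (C * norm (V \<omega>))"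
      by (intro AE_I2 order_trans[OF Ale]) auto
  qed (use V in measurable)

  show "h Ybar = h Y"
  proof
    fix x
    have "(\<integral>\<omega>. transpose (A (X \<omega>) (u \<omega>) x) *v Ybar \<omega> \<partial>M) = (\<integral>\<omega>. transpose (A (X \<omega>) (u \<omega>) x) *v Y \<omega> \<partial>M)"
    proof (rule euclidean_eqI)
      fix e :: "real^'d" assume "e \<in> Basis"
      then obtain i where i: "\<And>v :: real^'d. v \<bullet> e = v $ i" by (auto simp: Basis_vec_def inner_axis)
      \<comment> \<open>A coordinate of the matrix-vector product is an inner product with a row,
        which is a bounded \<open>G\<close>-measurable vector.\<close>
      have comp: "(\<integral>\<omega>. transpose (A (X \<omega>) (u \<omega>) x) *v V \<omega> \<partial>M) \<bullet> e
        = (\<integral>\<omega>. transpose (A (X \<omega>) (u \<omega>) x) $ i \<bullet> V \<omega> \<partial>M)" if "integrable M V" for V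
        using integral_inner_left[where c = e, OF intA[OF that]] by (simp only: i matrix_vector_mul_component)
      have TG: "(\<lambda>\<omega>. transpose (A (X \<omega>) (u \<omega>) x) $ i) \<in> borel_measurable G"
        by (intro borel_measurable_vec_nth borel_measurable_transpose AG)
      have le: "norm (transpose (A (X \<omega>) (u \<omega>) x) $ i) \<le> C" if "\<omega> \<in> space M" for \<omega>
        using A(2)[OF u(3)[OF that], of "X \<omega>" x] Finite_Cartesian_Product.norm_nth_le[of "transpose (A (X \<omega>) (u \<omega>) x)" i]
        by simp
      show "(\<integral>\<omega>. transpose (A (X \<omega>) (u \<omega>) x) *v Ybar \<omega> \<partial>M) \<bullet> e = (\<integral>\<omega>. transpose (A (X \<omega>) (u \<omega>) x) *v Y \<omega> \<partial>M) \<bullet> e"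
        unfolding comp[OF Y] comp[OF Ybar]
        by (rule integral_inner_cond_expectation_cong[OF finite_measure_axioms G TG le Ybar Y eq])
    qed
    then show "h Ybar x = h Y x"
      unfolding h_def Bochner_Integration.integral_add[OF intA[OF Y] intD]
        Bochner_Integration.integral_add[OF intA[OF Ybar] intD] by (rule arg_cong)
  qed

  \<comment> \<open>Joint measurability in \<open>(x, \<omega>)\<close> makes the integral over
    \<open>\<omega>\<close> measurable in the parameter \<open>x\<close>.\<close>
  show "h Y \<in> borel_measurable borel"
  proof -
    have pair: "(\<lambda>(x :: real^'d, \<omega>). (X \<omega>, u \<omega>, x)) \<in> borel_measurable (borel \<Otimes>\<^sub>M M)"
      unfolding case_prod_unfold by (intro borel_measurable_Pair) measurable
    have pS: "(\<lambda>(x :: real^'d, \<omega>). (X \<omega>, u \<omega>, x)) z \<in> UNIV \<times> U \<times> UNIV" if "z \<in> space (borel \<Otimes>\<^sub>M M)" for z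
      using that u(3) by (auto simp: space_pair_measure)
    have [measurable]: "(\<lambda>z. A (X (snd z)) (u (snd z)) (fst z)) \<in> borel_measurable (borel \<Otimes>\<^sub>M M)"
      "(\<lambda>z. D (X (snd z)) (u (snd z)) (fst z)) \<in> borel_measurable (borel \<Otimes>\<^sub>M M)"
      using measurable_compose_continuous_on[OF A(1) pair pS] measurable_compose_continuous_on[OF D(1) pair pS]
      by (simp_all add: case_prod_unfold)
    have "(\<lambda>(x, \<omega>). transpose (A (X \<omega>) (u \<omega>) x) *v Y \<omega> + D (X \<omega>) (u \<omega>) x) \<in> borel_measurable (borel \<Otimes>\<^sub>M M)"
      unfolding case_prod_unfold by measurable
    then show ?thesis unfolding h_def by (rule borel_measurable_lebesgue_integral)
  qed

  show "\<exists>a b. \<forall>x. norm (h Y x) \<le> a + b * norm x"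
  proof (intro exI allI)
    fix x
    have normY: "integrable M (\<lambda>\<omega>. norm (Y \<omega>))" using Y by auto
    have "norm (h Y x) \<le> (\<integral>\<omega>. norm (transpose (A (X \<omega>) (u \<omega>) x) *v Y \<omega> + D (X \<omega>) (u \<omega>) x) \<partial>M)"
      unfolding h_def by (rule integral_norm_bound)
    also have "\<dots> \<le> (\<integral>\<omega>. C * norm (Y \<omega>) + \<bar>K\<bar> * (1 + norm (X \<omega>) + norm (u \<omega>) + norm x + \<bar>m\<bar>) \<partial>M)"
    proof (rule integral_mono)
      show "integrable M (\<lambda>\<omega>. norm (transpose (A (X \<omega>) (u \<omega>) x) *v Y \<omega> + D (X \<omega>) (u \<omega>) x))"
        by (intro integrable_norm Bochner_Integration.integrable_add intA intD Y)
      show "integrable M (\<lambda>\<omega>. C * norm (Y \<omega>) + \<bar>K\<bar> * (1 + norm (X \<omega>) + norm (u \<omega>) + norm x + \<bar>m\<bar>))"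
        using normX normu normY by auto
      show "norm (transpose (A (X \<omega>) (u \<omega>) x) *v Y \<omega> + D (X \<omega>) (u \<omega>) x)
          \<le> C * norm (Y \<omega>) + \<bar>K\<bar> * (1 + norm (X \<omega>) + norm (u \<omega>) + norm x + \<bar>m\<bar>)" if "\<omega> \<in> space M" for \<omega>
        by (intro order_trans[OF norm_triangle_ineq] add_mono Ale Dle that)
    qed
    also have "\<dots> = (\<integral>\<omega>. C * norm (Y \<omega>) + \<bar>K\<bar> * (1 + norm (X \<omega>) + norm (u \<omega>) + \<bar>m\<bar>) \<partial>M) + \<bar>K\<bar> * norm x"
      using normX normu normY by (simp add: algebra_simps prob_space)
    finally show "norm (h Y x) \<le> (\<integral>\<omega>. C * norm (Y \<omega>) + \<bar>K\<bar> * (1 + norm (X \<omega>) + norm (u \<omega>) + \<bar>m\<bar>) \<partial>M) + \<bar>K\<bar> * norm x" .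
  qed
qed

lemma norm_sum_blinfun_Basis_le:
  fixes D :: "'v::euclidean_space \<Rightarrow>\<^sub>L real"
  shows "norm (\<Sum>i\<in>Basis. blinfun_apply D i *\<^sub>R i) \<le> real DIM('v) * norm D"
proof (rule order_trans[OF norm_sum sum_bounded_above[where K = "norm D", simplified]])
  fix i :: 'v assume "i \<in> Basis"
  then show "norm (blinfun_apply D i *\<^sub>R i) \<le> norm D" using norm_blinfun[of D i] by simp
qed

text \<open>\<open>x\<close> is the fixed point at which the Lions derivatives are evaluated,
  \<open>x'\<close> the state of the copy and \<open>y\<close> its adjoint value. Continuity in the
  latter and in \<open>u\<close> is what the transfer of expectations from the copy to
  \<open>M\<close> needs.\<close>

lemma continuous_on_mean_field_integrand:
  fixes A :: "real^'d \<Rightarrow> real^'c \<Rightarrow> real^'d \<Rightarrow> real^'d^'d" and D :: "real^'d \<Rightarrow> real^'c \<Rightarrow> real^'d \<Rightarrow> real^'d"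
  assumes A: "continuous_on (UNIV \<times> U \<times> UNIV) (\<lambda>(x, u, v). A x u v)"
    and D: "continuous_on (UNIV \<times> U \<times> UNIV) (\<lambda>(x, u, v). D x u v)"
  shows "continuous_on (UNIV \<times> U \<times> UNIV) (\<lambda>(x', u, y). transpose (A x' u x) *v y + D x' u x)"
proof -
  let ?p = "\<lambda>(x' :: real^'d, u, y :: real^'d). (x', u, x)"
  have p: "continuous_on (UNIV \<times> U \<times> UNIV) ?p" "?p ` (UNIV \<times> U \<times> UNIV) \<subseteq> UNIV \<times> U \<times> UNIV"
    by (auto simp: case_prod_unfold intro!: continuous_intros)
  have "continuous_on (UNIV \<times> U \<times> UNIV) (\<lambda>z :: _ \<times> _ \<times> (real^'d). A (fst z) (fst (snd z)) x)"
    "continuous_on (UNIV \<times> U \<times> UNIV) (\<lambda>z :: _ \<times> _ \<times> (real^'d). D (fst z) (fst (snd z)) x)"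
    using continuous_on_compose2[OF A p] continuous_on_compose2[OF D p] by (simp_all add: case_prod_unfold)
  then show ?thesis
    unfolding case_prod_unfold transpose_def
    by (intro continuous_on_add bounded_bilinear.continuous_on[OF bounded_bilinear_matrix_vector_mult]) (auto intro!: continuous_intros)
qed

theorem proposition2p2:
  fixes M :: "'a measure" and F :: "real \<Rightarrow> 'a measure" and M' :: "'b measure"
    and T dt :: real and N :: nat and t :: "nat \<Rightarrow> real"
    and U :: "(real^'c) set"
    and b :: "real \<Rightarrow> real^'d \<Rightarrow> (real^'d) measure \<Rightarrow> real^'c \<Rightarrow> real^'d"
    and \<sigma> :: "real \<Rightarrow> real^'d \<Rightarrow> real^'c \<Rightarrow> real^'m^'d"
    and f :: "real \<Rightarrow> real^'d \<Rightarrow> (real^'d) measure \<Rightarrow> real^'c \<Rightarrow> real"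
    and g :: "real^'d \<Rightarrow> (real^'d) measure \<Rightarrow> real"
    and Dmub :: "real \<Rightarrow> real^'d \<Rightarrow> (real^'d) measure \<Rightarrow> real^'c \<Rightarrow> real^'d \<Rightarrow> real^'d^'d"
    and Dmuf :: "real \<Rightarrow> real^'d \<Rightarrow> (real^'d) measure \<Rightarrow> real^'c \<Rightarrow> real^'d \<Rightarrow> real^'d"
    and Dmug :: "real^'d \<Rightarrow> (real^'d) measure \<Rightarrow> real^'d \<Rightarrow> real^'d"
    and W :: "real \<Rightarrow> 'a \<Rightarrow> real^'m" and dW :: "nat \<Rightarrow> 'a \<Rightarrow> real^'m"
    and \<phi> :: "real \<Rightarrow> real^'d \<Rightarrow> (real^'d) measure \<Rightarrow> real^'c"
    and X :: "nat \<Rightarrow> 'a \<Rightarrow> real^'d" and \<mu> :: "nat \<Rightarrow> (real^'d) measure"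
    and u :: "nat \<Rightarrow> 'a \<Rightarrow> real^'c"
    and Y Ybar :: "nat \<Rightarrow> 'a \<Rightarrow> real^'d" and Z Zbar :: "nat \<Rightarrow> 'a \<Rightarrow> real^'m^'d"
    and Xh Yh Ybarh :: "nat \<Rightarrow> 'b \<Rightarrow> real^'d" and uh :: "nat \<Rightarrow> 'b \<Rightarrow> real^'c"
  assumes prob: "prob_space M" "prob_space M'"
    and filt: "filtration (space M) F" "\<And>s. subalgebra M (F s)"
    and T: "T > 0" and N: "N \<ge> 1"
    and dt: "dt = T / real N" and t: "\<And>n. t n = real n * dt"
    \<comment> \<open>data and standing assumptions\<close>
    and data: "measurable_data T U b \<sigma> f g"
    and standing1: "lipschitz_growth_assumption T U b \<sigma> f g"
    and standing2: "differentiability_assumption M T U b \<sigma> f g Dmub Dmuf Dmug"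
    \<comment> \<open>Brownian motion and the controlled Euler scheme\<close>
    and W: "brownian_motion M F T W"
    and dW: "\<And>n \<omega>. dW n \<omega> = W (t (Suc n)) \<omega> - W (t n) \<omega>"
    and X0: "X 0 \<in> borel_measurable (F 0)" "distr M borel (X 0) \<in> P2"
      "prob_space.indep_set M (sets (vimage_algebra (space M) (X 0) borel))
         (sets (vimage_algebra (space M) (\<lambda>\<omega>. \<lambda>s\<in>{0..T}. W s \<omega>) (\<Pi>\<^sub>M s\<in>{0..T}. borel)))"
    and \<mu>: "\<And>n. \<mu> n = distr M borel (X n)"
    and \<phi>: "(\<lambda>(s, x, \<nu>). \<phi> s x \<nu>) \<in>
      measurable (restrict_space borel {0..T} \<Otimes>\<^sub>M borel \<Otimes>\<^sub>M P2_borel) (restrict_space borel U)"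
    and u: "\<And>n \<omega>. n \<le> N \<Longrightarrow> \<omega> \<in> space M \<Longrightarrow> u n \<omega> = \<phi> (t n) (X n \<omega>) (\<mu> n)"
    and X_Suc: "\<And>n \<omega>. n < N \<Longrightarrow> \<omega> \<in> space M \<Longrightarrow>
      X (Suc n) \<omega> = X n \<omega> + dt *\<^sub>R b (t n) (X n \<omega>) (\<mu> n) (u n \<omega>)
                    + \<sigma> (t n) (X n \<omega>) (u n \<omega>) *v dW n \<omega>"
    and admissible: "\<And>n. n < N \<Longrightarrow> u n \<in> L2 M"
      "\<And>n. n < N \<Longrightarrow> (\<lambda>\<omega>. b (t n) 0 (return borel 0) (u n \<omega>)) \<in> L2 M"
      "\<And>n. n < N \<Longrightarrow> (\<lambda>\<omega>. \<sigma> (t n) 0 (u n \<omega>)) \<in> L2 M"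
    \<comment> \<open>the independent copy\<close>
    and copy: "copy_of_family M' (\<lambda>n \<omega>. (Xh n \<omega>, uh n \<omega>, Yh n \<omega>, Ybarh n \<omega>))
                              M (\<lambda>n \<omega>. (X n \<omega>, u n \<omega>, Y n \<omega>, Ybar n \<omega>)) {..N}"
      "\<And>n \<omega>. n \<le> N \<Longrightarrow> \<omega> \<in> space M' \<Longrightarrow> uh n \<omega> \<in> U"
    \<comment> \<open>the backward Euler scheme\<close>
    and Y_meas: "\<And>n. n \<le> N \<Longrightarrow> Y n \<in> borel_measurable M"
    and Z_meas: "\<And>n. n < N \<Longrightarrow> Z n \<in> borel_measurable M"
    and Y_N: "AE \<omega> in M. Y N \<omega> = grad (\<lambda>x. g x (\<mu> N)) (X N \<omega>)
                                  + (\<integral>\<omega>'. Dmug (Xh N \<omega>') (\<mu> N) (X N \<omega>) \<partial>M')"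
    and Z_n: "\<And>n. n < N \<Longrightarrow> AE \<omega> in M.
      Z n \<omega> = (1 / dt) *\<^sub>R
        cond_expectation M (F (t n)) (\<lambda>\<omega>. outer_product (Y (Suc n) \<omega>) (dW n \<omega>)) \<omega>"
    and Y_n: "\<And>n. n < N \<Longrightarrow> AE \<omega> in M.
      Y n \<omega> =
        cond_expectation M (F (t n)) (\<lambda>\<omega>. Y (Suc n) \<omega> + dt *\<^sub>R
          grad_x_hamiltonian b \<sigma> f (t n) (X n \<omega>) (\<mu> n) (Y (Suc n) \<omega>) (Z n \<omega>) (u n \<omega>)) \<omega>
        + dt *\<^sub>R (\<integral>\<omega>'. transpose (Dmub (t n) (Xh n \<omega>') (\<mu> n) (uh n \<omega>') (X n \<omega>)) *v Yh (Suc n) \<omega>'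
                       + Dmuf (t n) (Xh n \<omega>') (\<mu> n) (uh n \<omega>') (X n \<omega>) \<partial>M')"
    \<comment> \<open>the sample-wise recursion\<close>
    and Ybar_meas: "\<And>n. n \<le> N \<Longrightarrow> Ybar n \<in> borel_measurable M"
    and Zbar_meas: "\<And>n. n < N \<Longrightarrow> Zbar n \<in> borel_measurable M"
    and Ybar_N: "AE \<omega> in M. Ybar N \<omega> = grad (\<lambda>x. g x (\<mu> N)) (X N \<omega>)
                                  + (\<integral>\<omega>'. Dmug (Xh N \<omega>') (\<mu> N) (X N \<omega>) \<partial>M')"
    and Zbar_n: "\<And>n. n < N \<Longrightarrow> AE \<omega> in M.
      Zbar n \<omega> = (1 / dt) *\<^sub>R outer_product (Ybar (Suc n) \<omega>) (dW n \<omega>)"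
    and Ybar_n: "\<And>n. n < N \<Longrightarrow> AE \<omega> in M.
      Ybar n \<omega> = Ybar (Suc n) \<omega> + dt *\<^sub>R
          grad_x_hamiltonian b \<sigma> f (t n) (X n \<omega>) (\<mu> n) (Ybar (Suc n) \<omega>) (Zbar n \<omega>) (u n \<omega>)
        + dt *\<^sub>R (\<integral>\<omega>'. transpose (Dmub (t n) (Xh n \<omega>') (\<mu> n) (uh n \<omega>') (X n \<omega>)) *v Ybarh (Suc n) \<omega>'
                       + Dmuf (t n) (Xh n \<omega>') (\<mu> n) (uh n \<omega>') (X n \<omega>) \<partial>M')"
  shows "\<forall>n<N.
      integrable M (Ybar n) \<and> integrable M (Zbar n) \<and> integrable M (Y n) \<and> integrable M (Z n) \<and>
      (AE \<omega> in M. cond_expectation M (F (t n)) (Ybar n) \<omega> = Y n \<omega>) \<and>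
      (AE \<omega> in M. cond_expectation M (F (t n)) (Zbar n) \<omega> = Z n \<omega>) \<and>
      (\<integral>\<omega>. Ybar n \<omega> \<partial>M) = (\<integral>\<omega>. Y n \<omega> \<partial>M) \<and>
      (\<integral>\<omega>. Zbar n \<omega> \<partial>M) = (\<integral>\<omega>. Z n \<omega> \<partial>M)"
proof -
  interpret prob_space M by (rule prob(1))
  interpret M': prob_space M' by (rule prob(2))
  interpret filtration "space M" F by (rule filt(1))
  have fin: "finite_measure M" by unfold_locales
  have dt_pos: "dt > 0" using T N dt by simp
  have t_less: "t n < t (Suc n)" for n using dt_pos by (simp add: t algebra_simps)
  have t_mem: "t n \<in> {0..T}" if "n \<le> N" for n
  proof -
    have "real n * dt \<le> real N * dt" using that dt_pos by (intro mult_right_mono) auto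
    moreover have "real N * dt = T" using N by (simp add: dt)
    ultimately show ?thesis using dt_pos by (simp add: t)
  qed
  have sub: "subalgebra (F (t (Suc n))) (F (t n))" for n
    using sets_F_mono[OF less_imp_le[OF t_less]] by (simp add: subalgebra_def space_F)

  \<comment> \<open>Brownian increments on the grid\<close>
  have dW_eq: "dW n = (\<lambda>\<omega>. W (t (Suc n)) \<omega> - W (t n) \<omega>)" for n using dW by blast
  have dW_meas: "dW n \<in> borel_measurable (F (t (Suc n)))" if "n < N" for n
  proof -
    have W_meas: "W s \<in> borel_measurable (F s)" if "s \<in> {0..T}" for s
      using W that by (simp add: brownian_motion_def)
    have "W (t n) \<in> borel_measurable (F (t n))" "W (t (Suc n)) \<in> borel_measurable (F (t (Suc n)))"
      using that by (intro W_meas t_mem; simp)+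
    from borel_measurable_diff[OF this(2) measurable_from_subalg[OF sub this(1)]] show ?thesis
      unfolding dW_eq .
  qed
  have dW_law: "indep_set (sets (F (t n))) (sets (vimage_algebra (space M) (dW n) borel))"
    "distributed M lborel (dW n) (\<lambda>x. ennreal (\<Prod>j\<in>UNIV. normal_density 0 (sqrt (t (Suc n) - t n)) (x $ j)))"
    if "n < N" for n
    using W t_mem[of n] t_mem[of "Suc n"] t_less[of n] that unfolding brownian_motion_def dW_eq by auto
  have dW_mom: "has_all_moments M (\<lambda>\<omega>. dW n \<omega> $ j)" if "n < N" for n j
    by (rule has_all_moments_gaussian[OF dW_law(2)[OF that]]) (use t_less in simp)
  have dW_L2: "dW n \<in> L2 M" if "n < N" for n
    by (intro L2_if_has_all_moments dW_mom that measurable_from_subalg[OF filt(2) dW_meas])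

  \<comment> \<open>Forward scheme: adaptedness and square integrability\<close>
  have u_of_X: "u n \<in> measurable (F (t n)) (restrict_space borel U)"
    if n: "n \<le> N" and X: "X n \<in> borel_measurable (F (t n))" "X n \<in> L2 M" for n
  proof -
    have "\<mu> n \<in> P2" unfolding \<mu> by (rule distr_in_P2[OF X(2)])
    then have "(\<lambda>\<omega>. (t n, X n \<omega>, \<mu> n)) \<in> measurable (F (t n)) (restrict_space borel {0..T} \<Otimes>\<^sub>M borel \<Otimes>\<^sub>M P2_borel)"
      using t_mem[OF n] by (intro measurable_Pair X measurable_const) (auto simp: space_P2_borel space_restrict_space)
    from measurable_compose[OF this \<phi>]
    have "(\<lambda>\<omega>. \<phi> (t n) (X n \<omega>) (\<mu> n)) \<in> measurable (F (t n)) (restrict_space borel U)" by simp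
    then show ?thesis
      using u[OF n] by (subst measurable_cong[where g = "\<lambda>\<omega>. \<phi> (t n) (X n \<omega>) (\<mu> n)"]) (simp_all add: space_F)
  qed
  obtain L where L': "\<forall>t\<in>{0..T}. \<forall>a\<in>U. \<forall>x x'. \<forall>\<mu>\<in>P2. \<forall>\<mu>'\<in>P2.
       norm (b t x \<mu> a - b t x' \<mu>' a) \<le> L * (norm (x - x') + W2 \<mu> \<mu>') \<and>
       norm (\<sigma> t x a - \<sigma> t x' a) \<le> L * norm (x - x')"
    using standing1 unfolding lipschitz_growth_assumption_def by (elim conjE exE) (erule that)
  have L: "norm (b s x \<nu> a - b s x' \<nu>' a) \<le> L * (norm (x - x') + W2 \<nu> \<nu>') \<and> norm (\<sigma> s x a - \<sigma> s x' a) \<le> L * norm (x - x')"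
    if "s \<in> {0..T}" "a \<in> U" "\<nu> \<in> P2" "\<nu>' \<in> P2" for s a x x' \<nu> \<nu>'
    using L' that by blast
  have data_b: "(\<lambda>(t, x, \<mu>, u). b t x \<mu> u) \<in> borel_measurable
      (restrict_space borel {0..T} \<Otimes>\<^sub>M borel \<Otimes>\<^sub>M P2_borel \<Otimes>\<^sub>M restrict_space borel U)"
    and data_s: "(\<lambda>(t, x, u). \<sigma> t x u) \<in> borel_measurable
      (restrict_space borel {0..T} \<Otimes>\<^sub>M borel \<Otimes>\<^sub>M restrict_space borel U)"
    using data unfolding measurable_data_def by blast+
  \<comment> \<open>The Dirac measure is the law of a constant, hence an element of
    \<open>P2\<close>.\<close>
  have delta: "return borel 0 \<in> (P2 :: (real^'d) measure set)"
    using distr_in_P2[OF L2_const[of "0 :: real^'d"]] by (simp add: distr_const)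

  \<comment> \<open>The two properties must be carried together: measurability of the control and of
    the drift uses that the law of \<open>X n\<close> lies in \<open>P2\<close>, that is, square
    integrability, while adaptedness provides the independence from \<open>dW n\<close> that makes
    the next state square integrable.\<close>
  have X_props: "X n \<in> borel_measurable (F (t n)) \<and> X n \<in> L2 M" if "n \<le> N" for n
    using that
  proof (induction n)
    case 0
    have "t 0 = 0" by (simp add: t)
    then show ?case
      using X0 L2_iff_distr_in_P2[OF measurable_from_subalg[OF filt(2) X0(1)]] by simp
  next
    case (Suc n)
    then have n: "n < N" "n \<le> N" and XF: "X n \<in> borel_measurable (F (t n))" and XL: "X n \<in> L2 M" by auto
    have uF: "u n \<in> measurable (F (t n)) (restrict_space borel U)" by (rule u_of_X[OF n(2) XF XL])
    have uU: "u n \<omega> \<in> U" if "\<omega> \<in> space M" for \<omega>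
      using measurable_space[OF uF] that by (simp add: space_F space_restrict_space)
    have \<mu>P2: "\<mu> n \<in> P2" unfolding \<mu> by (rule distr_in_P2[OF XL])
    have bF: "(\<lambda>\<omega>. b (t n) (X n \<omega>) (\<mu> n) (u n \<omega>)) \<in> borel_measurable (F (t n))"
      by (rule measurable_data_compose[OF data_b t_mem[OF n(2)] \<mu>P2 XF uF])
    have \<sigma>F: "(\<lambda>\<omega>. \<sigma> (t n) (X n \<omega>) (u n \<omega>)) \<in> borel_measurable (F (t n))"
    proof -
      have txu: "(\<lambda>\<omega>. (t n, X n \<omega>, u n \<omega>)) \<in> measurable (F (t n)) (restrict_space borel {0..T} \<Otimes>\<^sub>M borel \<Otimes>\<^sub>M restrict_space borel U)"
        using t_mem[OF n(2)] by (intro measurable_Pair XF uF measurable_const) (auto simp: space_restrict_space)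
      from measurable_compose[OF txu data_s] show ?thesis by simp
    qed
    have bL: "(\<lambda>\<omega>. b (t n) (X n \<omega>) (\<mu> n) (u n \<omega>)) \<in> L2 M"
    proof (rule L2_linear_growth[OF measurable_from_subalg[OF filt(2) bF] admissible(2)[OF n(1)] XL])
      \<comment> \<open>Comparison with the admissible value at state 0 and Dirac law. The law
        enters only through its distance to the Dirac measure, a constant; absolute values are taken
        so that no sign of \<open>L\<close> or of the distance has to be known.\<close>
      let ?c = "\<bar>L\<bar> * \<bar>W2 (\<mu> n) (return borel 0)\<bar>"
      show "AE \<omega> in M. norm (b (t n) (X n \<omega>) (\<mu> n) (u n \<omega>))
        \<le> ?c + (1 + \<bar>L\<bar>) * (norm (b (t n) 0 (return borel 0) (u n \<omega>)) + norm (X n \<omega>))"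
      proof (intro AE_I2)
        fix \<omega> assume "\<omega> \<in> space M"
        let ?b0 = "b (t n) 0 (return borel 0) (u n \<omega>)"
        have "norm (b (t n) (X n \<omega>) (\<mu> n) (u n \<omega>) - ?b0) \<le> L * (norm (X n \<omega>) + W2 (\<mu> n) (return borel 0))"
          using L[OF t_mem[OF n(2)] uU[OF \<open>\<omega> \<in> space M\<close>] \<mu>P2 delta, of "X n \<omega>" 0] by simp
        also have "\<dots> \<le> \<bar>L\<bar> * (norm (X n \<omega>) + \<bar>W2 (\<mu> n) (return borel 0)\<bar>)"
          using norm_ge_zero[of "X n \<omega>"]
          by (intro order_trans[OF abs_ge_self[of "L * (_ + _)"]]) (unfold abs_mult, intro mult_left_mono abs_ge_zero, linarith)
        finally have "norm (b (t n) (X n \<omega>) (\<mu> n) (u n \<omega>)) \<le> norm ?b0 + \<bar>L\<bar> * (norm (X n \<omega>) + \<bar>W2 (\<mu> n) (return borel 0)\<bar>)"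
          using norm_triangle_sub[of "b (t n) (X n \<omega>) (\<mu> n) (u n \<omega>)" ?b0] by linarith
        moreover have "0 \<le> norm (X n \<omega>)" "0 \<le> \<bar>L\<bar> * norm ?b0" by auto
        ultimately show "norm (b (t n) (X n \<omega>) (\<mu> n) (u n \<omega>)) \<le> ?c + (1 + \<bar>L\<bar>) * (norm ?b0 + norm (X n \<omega>))"
          unfolding distrib_left distrib_right by linarith
      qed
    qed
    have \<sigma>L: "(\<lambda>\<omega>. \<sigma> (t n) (X n \<omega>) (u n \<omega>)) \<in> L2 M"
    proof (rule L2_linear_growth[OF measurable_from_subalg[OF filt(2) \<sigma>F] admissible(3)[OF n(1)] XL])
      show "AE \<omega> in M. norm (\<sigma> (t n) (X n \<omega>) (u n \<omega>))
        \<le> 0 + (1 + \<bar>L\<bar>) * (norm (\<sigma> (t n) 0 (u n \<omega>)) + norm (X n \<omega>))"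
      proof (intro AE_I2)
        fix \<omega> assume "\<omega> \<in> space M"
        let ?s0 = "\<sigma> (t n) 0 (u n \<omega>)"
        have "norm (\<sigma> (t n) (X n \<omega>) (u n \<omega>) - ?s0) \<le> L * norm (X n \<omega>)"
          using L[OF t_mem[OF n(2)] uU[OF \<open>\<omega> \<in> space M\<close>] \<mu>P2 delta, of "X n \<omega>" 0] by simp
        also have "\<dots> \<le> \<bar>L\<bar> * norm (X n \<omega>)" by (intro mult_right_mono) auto
        finally have "norm (\<sigma> (t n) (X n \<omega>) (u n \<omega>)) \<le> norm ?s0 + \<bar>L\<bar> * norm (X n \<omega>)"
          using norm_triangle_sub[of "\<sigma> (t n) (X n \<omega>) (u n \<omega>)" ?s0] by linarith
        moreover have "0 \<le> norm (X n \<omega>)" "0 \<le> \<bar>L\<bar> * norm ?s0" by auto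
        ultimately show "norm (\<sigma> (t n) (X n \<omega>) (u n \<omega>)) \<le> 0 + (1 + \<bar>L\<bar>) * (norm ?s0 + norm (X n \<omega>))"
          unfolding distrib_left distrib_right by linarith
      qed
    qed
    define R where "R = (\<lambda>\<omega>. X n \<omega> + dt *\<^sub>R b (t n) (X n \<omega>) (\<mu> n) (u n \<omega>) + \<sigma> (t n) (X n \<omega>) (u n \<omega>) *v dW n \<omega>)"
    have R: "X (Suc n) \<omega> = R \<omega>" if "\<omega> \<in> space M" for \<omega> using X_Suc[OF n(1) that] by (simp add: R_def)
    have "R \<in> borel_measurable (F (t (Suc n)))"
      unfolding R_def
      by (intro borel_measurable_add borel_measurable_scaleR borel_measurable_const borel_measurable_matrix_vector_mult
          dW_meas n measurable_from_subalg[OF sub XF] measurable_from_subalg[OF sub bF] measurable_from_subalg[OF sub \<sigma>F])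
    then have XS: "X (Suc n) \<in> borel_measurable (F (t (Suc n)))"
      using R by (subst measurable_cong[where g = R]) (simp_all add: space_F)
    have "R \<in> L2 M"
      unfolding R_def
      by (intro L2_add L2_scaleR XL bL L2_matrix_vector_mult_indep[OF filt(2) \<sigma>F \<sigma>L] dW_L2 dW_law n)
    then have "X (Suc n) \<in> L2 M"
      by (rule L2_dominated[OF measurable_from_subalg[OF filt(2) XS]]) (auto intro: AE_I2 simp: R)
    with XS show ?case by simp
  qed
  have XF: "X n \<in> borel_measurable (F (t n))" and XL: "X n \<in> L2 M" and \<mu>P2: "\<mu> n \<in> P2"
    and uF: "u n \<in> measurable (F (t n)) (restrict_space borel U)" if "n \<le> N" for n
    using X_props[OF that] u_of_X[OF that] distr_in_P2[of "X n"] by (auto simp: \<mu>)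
  have uU: "u n \<omega> \<in> U" if "n \<le> N" "\<omega> \<in> space M" for n \<omega>
    using measurable_space[OF uF[OF that(1)]] that(2) by (simp add: space_F space_restrict_space)
  have uFb: "u n \<in> borel_measurable (F (t n))" if "n \<le> N" for n
    using uF[OF that] by (simp add: measurable_restrict_space2_iff)

  \<comment> \<open>Terminal value\<close>
  have terminal: "moderate M V"
    if V: "V \<in> borel_measurable M" and VN: "AE \<omega> in M. V \<omega> = grad (\<lambda>x. g x (\<mu> N)) (X N \<omega>)
        + (\<integral>\<omega>'. Dmug (Xh N \<omega>') (\<mu> N) (X N \<omega>) \<partial>M')" for V
  proof (rule moderate_L2)
    obtain Dxg C where Dxg':
      "\<forall>x. \<forall>\<mu>\<in>P2. ((\<lambda>x'. g x' \<mu>) has_derivative blinfun_apply (Dxg x \<mu>)) (at x)"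
      "\<forall>x. \<forall>\<mu>\<in>P2. norm (Dxg x \<mu>) \<le> C * (1 + norm x + sqrt (second_moment \<mu>))"
      using standing2 unfolding differentiability_assumption_def
      by (elim conjE exE) (erule (1) that)
    have Dxg: "((\<lambda>x'. g x' (\<mu> N)) has_derivative blinfun_apply (Dxg x (\<mu> N))) (at x)"
      "norm (Dxg x (\<mu> N)) \<le> C * (1 + norm x + sqrt (second_moment (\<mu> N)))" for x
      using Dxg' \<mu>P2[OF order_refl] by blast+
    obtain C' where "\<forall>x. \<forall>\<mu>\<in>P2. \<forall>v. norm (Dmug x \<mu> v) \<le> C' * (1 + norm x + norm v + sqrt (second_moment \<mu>))"
      using standing2 unfolding differentiability_assumption_def by (elim conjE exE) (erule that)
    then have C': "norm (Dmug x (\<mu> N) v) \<le> C' * (1 + norm x + norm v + sqrt (second_moment (\<mu> N)))" for x v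
      using \<mu>P2[OF order_refl] by blast
    define s where "s = \<bar>sqrt (second_moment (\<mu> N))\<bar>"
    \<comment> \<open>The copy has the law \<open>\<mu> N\<close>. This gives the integrability over
      the copy that growth of \<open>Dmug\<close> in its first argument calls for.\<close>
    have Xh: "Xh N \<in> L2 M'"
    proof -
      have p: "(\<lambda>v. fst (v N)) \<in> borel_measurable (\<Pi>\<^sub>M i\<in>{..N}. borel :: ((real^'d) \<times> (real^'c) \<times> (real^'d) \<times> (real^'d)) measure)"
        by (rule borel_measurable_component_compose[where s = fst]) (auto intro!: continuous_intros)
      have "distr M' borel (Xh N) = \<mu> N"
        using copy_of_family_distr[OF copy(1) p] by (simp add: \<mu>)
      moreover have "Xh N \<in> borel_measurable M'"
      proof -
        have "(\<lambda>\<omega>. (Xh N \<omega>, uh N \<omega>, Yh N \<omega>, Ybarh N \<omega>)) \<in> borel_measurable M'"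
          using copy(1) by (simp add: copy_of_family_def)
        from measurable_compose[OF this borel_measurable_continuous_onI[of fst]]
        show ?thesis by (simp add: continuous_on_fst)
      qed
      ultimately show ?thesis using \<mu>P2[of N] by (simp add: M'.L2_iff_distr_in_P2)
    qed
    have intXh: "integrable M' (\<lambda>\<omega>'. norm (Xh N \<omega>'))" using M'.L2_integrable[OF Xh] by auto
    define E where "E = (\<integral>\<omega>'. norm (Xh N \<omega>') \<partial>M')"
    let ?d = "real DIM(real^'d)"
    \<comment> \<open>The terminal value grows in the state alone, so the constant 0 serves as the
      second dominating variable.\<close>
    show "V \<in> L2 M"
    proof (rule L2_linear_growth[OF V XL[OF order_refl] L2_const[of "0 :: real"]])
      show "AE \<omega> in M. norm (V \<omega>) \<le> (?d * \<bar>C\<bar> * (1 + s) + \<bar>C'\<bar> * (1 + E + s)) + (?d * \<bar>C\<bar> + \<bar>C'\<bar>) * (norm (X N \<omega>) + norm (0 :: real))"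
        using VN
      proof eventually_elim
        case (elim \<omega>)
        let ?x = "X N \<omega>"
        have "norm (grad (\<lambda>x. g x (\<mu> N)) ?x) \<le> ?d * norm (Dxg ?x (\<mu> N))"
          unfolding grad_has_derivative[OF Dxg(1)] by (rule norm_sum_blinfun_Basis_le)
        also have "\<dots> \<le> ?d * (\<bar>C\<bar> * (1 + norm ?x + s))"
        proof (intro mult_left_mono)
          have "norm (Dxg ?x (\<mu> N)) \<le> \<bar>C * (1 + norm ?x + sqrt (second_moment (\<mu> N)))\<bar>"
            using Dxg(2)[of ?x] by linarith
          also have "\<dots> \<le> \<bar>C\<bar> * (1 + norm ?x + s)"
            unfolding abs_mult s_def using norm_ge_zero[of ?x] by (intro mult_left_mono abs_ge_zero) linarith
          finally show "norm (Dxg ?x (\<mu> N)) \<le> \<bar>C\<bar> * (1 + norm ?x + s)" .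
        qed simp
        finally have 1: "norm (grad (\<lambda>x. g x (\<mu> N)) ?x) \<le> ?d * (\<bar>C\<bar> * (1 + norm ?x + s))" .
        have "norm (\<integral>\<omega>'. Dmug (Xh N \<omega>') (\<mu> N) ?x \<partial>M') \<le> (\<integral>\<omega>'. norm (Dmug (Xh N \<omega>') (\<mu> N) ?x) \<partial>M')"
          by (rule integral_norm_bound)
        \<comment> \<open>Only the dominating function has to be integrable: a non-integrable
          integrand would have the default integral 0, below this nonnegative bound.\<close>
        also have "\<dots> \<le> (\<integral>\<omega>'. \<bar>C'\<bar> * (1 + norm (Xh N \<omega>') + norm ?x + s) \<partial>M')"
        proof (rule integral_mono')
          show "integrable M' (\<lambda>\<omega>'. \<bar>C'\<bar> * (1 + norm (Xh N \<omega>') + norm ?x + s))" using intXh by auto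
          fix \<omega>'
          have "norm (Dmug (Xh N \<omega>') (\<mu> N) ?x) \<le> \<bar>C' * (1 + norm (Xh N \<omega>') + norm ?x + sqrt (second_moment (\<mu> N)))\<bar>"
            using C'[of "Xh N \<omega>'" ?x] by linarith
          also have "\<dots> \<le> \<bar>C'\<bar> * (1 + norm (Xh N \<omega>') + norm ?x + s)"
            unfolding abs_mult s_def using norm_ge_zero[of ?x] norm_ge_zero[of "Xh N \<omega>'"]
            by (intro mult_left_mono abs_ge_zero) linarith
          finally show "norm (Dmug (Xh N \<omega>') (\<mu> N) ?x) \<le> \<bar>C'\<bar> * (1 + norm (Xh N \<omega>') + norm ?x + s)" .
          show "0 \<le> \<bar>C'\<bar> * (1 + norm (Xh N \<omega>') + norm ?x + s)" by (simp add: s_def)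
        qed
        also have "\<dots> = \<bar>C'\<bar> * (1 + E + norm ?x + s)"
          using intXh by (simp add: E_def M'.prob_space)
        finally have "norm (\<integral>\<omega>'. Dmug (Xh N \<omega>') (\<mu> N) ?x \<partial>M') \<le> \<bar>C'\<bar> * (1 + E + norm ?x + s)" .
        with 1 have "norm (V \<omega>) \<le> ?d * (\<bar>C\<bar> * (1 + norm ?x + s)) + \<bar>C'\<bar> * (1 + E + norm ?x + s)"
          unfolding elim by (intro order_trans[OF norm_triangle_ineq] add_mono)
        also have "\<dots> = (?d * \<bar>C\<bar> * (1 + s) + \<bar>C'\<bar> * (1 + E + s)) + (?d * \<bar>C\<bar> + \<bar>C'\<bar>) * (norm ?x + norm (0 :: real))"
          by (simp add: algebra_simps)
        finally show ?case .
      qed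
    qed
  qed

  \<comment> \<open>One backward step for the actual processes\<close>
  define good where "good n \<longleftrightarrow> moderate M (Y n) \<and> moderate M (Ybar n) \<and>
      (AE \<omega> in M. cond_expectation M (F (t n)) (Ybar n) \<omega> = cond_expectation M (F (t n)) (Y n) \<omega>)" for n
  have backward: "good n \<and> moderate M (Z n) \<and> moderate M (Zbar n) \<and>
      (AE \<omega> in M. cond_expectation M (F (t n)) (Ybar n) \<omega> = Y n \<omega>) \<and>
      (AE \<omega> in M. cond_expectation M (F (t n)) (Zbar n) \<omega> = Z n \<omega>)" if n: "n < N" and good: "good (Suc n)" for n
  proof -
    interpret G: finite_measure_subalgebra M "F (t n)" by unfold_locales (rule filt(2))
    have nN: "n \<le> N" "Suc n \<le> N" using n by auto
    note uU' = uU[OF nN(1)]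
    note tn = t_mem[OF nN(1)] and \<mu>n = \<mu>P2[OF nN(1)]
    have y: "moderate M (Y (Suc n))" and ybar: "moderate M (Ybar (Suc n))"
      and eq: "AE \<omega> in M. cond_expectation M (F (t (Suc n))) (Ybar (Suc n)) \<omega> = cond_expectation M (F (t (Suc n))) (Y (Suc n)) \<omega>"
      using good by (auto simp: good_def)

    obtain Dxb Dub Cb where "\<forall>t\<in>{0..T}. C1_in_xu U (b t) (Dxb t) (Dub t) \<and>
       (\<forall>x. \<forall>\<mu>\<in>P2. \<forall>u\<in>U. norm (Dxb t x \<mu> u) \<le> Cb \<and> norm (Dub t x \<mu> u) \<le> Cb)"
      using standing2 unfolding differentiability_assumption_def by (elim conjE exE) (erule that)
    then have Dxb: "C1_in_xu U (b (t n)) (Dxb (t n)) (Dub (t n))"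
      "\<And>x a. a \<in> U \<Longrightarrow> norm (Dxb (t n) x (\<mu> n) a) \<le> Cb"
      using tn \<mu>n by blast+
    obtain Dxs Dus Cs where "\<forall>t\<in>{0..T}. C1_in_xu U (\<lambda>x _ u. \<sigma> t x u) (\<lambda>x _ u. Dxs t x u) (\<lambda>x _ u. Dus t x u) \<and>
       (\<forall>x. \<forall>u\<in>U. norm (Dxs t x u) \<le> Cs \<and> norm (Dus t x u) \<le> Cs)"
      using standing2 unfolding differentiability_assumption_def by (elim conjE exE) (erule that)
    then have Dxs: "C1_in_xu U (\<lambda>x _ u. \<sigma> (t n) x u) (\<lambda>x _ u. Dxs (t n) x u) (\<lambda>x _ u. Dus (t n) x u)"
      "\<And>x a. a \<in> U \<Longrightarrow> norm (Dxs (t n) x a) \<le> Cs"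
      using tn by blast+
    obtain Dxf Duf Cf where "\<forall>t\<in>{0..T}. C1_in_xu U (f t) (Dxf t) (Duf t) \<and>
       (\<forall>x. \<forall>\<mu>\<in>P2. \<forall>u\<in>U.
          norm (Dxf t x \<mu> u) \<le> Cf * (1 + norm x + norm u + sqrt (second_moment \<mu>)) \<and>
          norm (Duf t x \<mu> u) \<le> Cf * (1 + norm x + norm u + sqrt (second_moment \<mu>)))"
      using standing2 unfolding differentiability_assumption_def by (elim conjE exE) (erule that)
    then have Dxf: "C1_in_xu U (f (t n)) (Dxf (t n)) (Duf (t n))"
      "\<And>x a. a \<in> U \<Longrightarrow> norm (Dxf (t n) x (\<mu> n) a) \<le> Cf * (1 + norm x + norm a + sqrt (second_moment (\<mu> n)))"
      using tn \<mu>n by blast+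
    have "\<forall>t\<in>{0..T}. continuous_map
         (prod_topology euclidean (prod_topology W2_topology (prod_topology (top_of_set U) euclidean)))
         euclidean (\<lambda>(x, \<mu>, u, v). Dmub t x \<mu> u v)"
      using standing2 unfolding differentiability_assumption_def ball_conj_distrib by (elim conjE)
    note Dmub = bspec[OF this tn]
    have "\<forall>t\<in>{0..T}. continuous_map
         (prod_topology euclidean (prod_topology W2_topology (prod_topology (top_of_set U) euclidean)))
         euclidean (\<lambda>(x, \<mu>, u, v). Dmuf t x \<mu> u v)"
      using standing2 unfolding differentiability_assumption_def ball_conj_distrib by (elim conjE)
    note Dmuf = bspec[OF this tn]
    obtain CA where "\<forall>t\<in>{0..T}. \<forall>x. \<forall>\<mu>\<in>P2. \<forall>u\<in>U. \<forall>v. norm (Dmub t x \<mu> u v) \<le> CA"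
      using standing2 unfolding differentiability_assumption_def by (elim conjE exE) (erule that)
    then have CA: "norm (Dmub (t n) x (\<mu> n) a v) \<le> CA" if "a \<in> U" for x a v
      using tn \<mu>n that by blast
    obtain CD where "\<forall>t\<in>{0..T}. \<forall>x. \<forall>\<mu>\<in>P2. \<forall>u\<in>U. \<forall>v.
       norm (Dmuf t x \<mu> u v) \<le> CD * (1 + norm x + norm u + norm v + sqrt (second_moment \<mu>))"
      using standing2 unfolding differentiability_assumption_def by (elim conjE exE) (erule that)
    then have CD: "norm (Dmuf (t n) x (\<mu> n) a v) \<le> CD * (1 + norm x + norm a + norm v + sqrt (second_moment (\<mu> n)))"
      if "a \<in> U" for x a v
      using tn \<mu>n that by blast

    define A where "A = (\<lambda>x u v. Dmub (t n) x (\<mu> n) u v)"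
    define D where "D = (\<lambda>x u v. Dmuf (t n) x (\<mu> n) u v)"
    \<comment> \<open>The mean-field expectation with the copy replaced by the original variables
      and the outer state frozen at \<open>x\<close>.\<close>
    define h where "h V x = (\<integral>\<omega>. transpose (A (X n \<omega>) (u n \<omega>) x) *v V \<omega> + D (X n \<omega>) (u n \<omega>) x \<partial>M)" for V x
    have contA: "continuous_on (UNIV \<times> U \<times> UNIV) (\<lambda>(x, u, v). A x u v)"
      unfolding A_def by (rule continuous_on_slice_xuv[OF Dmub \<mu>n])
    have contD: "continuous_on (UNIV \<times> U \<times> UNIV) (\<lambda>(x, u, v). D x u v)"
      unfolding D_def by (rule continuous_on_slice_xuv[OF Dmuf \<mu>n])
    have boundA: "norm (A x a v) \<le> CA" if "a \<in> U" for x a v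
      unfolding A_def using CA[OF that] .
    have boundD: "norm (D x a v) \<le> CD * (1 + norm x + norm a + norm v + sqrt (second_moment (\<mu> n)))" if "a \<in> U" for x a v
      unfolding D_def using CD[OF that] .
    \<comment> \<open>The information used is that of \<open>t (Suc n)\<close>, where the equality
      \<open>eq\<close> is known; \<open>X n\<close> and \<open>u n\<close> are therefore lifted to
      this later time.\<close>
    note mean_field = mean_field_term[OF prob(1) filt(2) contA boundA contD boundD
        measurable_from_subalg[OF sub XF[OF nN(1)]] XL[OF nN(1)] measurable_from_subalg[OF sub uFb[OF nN(1)]]
        admissible(1)[OF n] uU' moderate_integrable[OF y] moderate_integrable[OF ybar] eq, folded h_def]
    have hat: "(\<integral>\<omega>'. transpose (Dmub (t n) (Xh n \<omega>') (\<mu> n) (uh n \<omega>') x) *v Yh (Suc n) \<omega>'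
                       + Dmuf (t n) (Xh n \<omega>') (\<mu> n) (uh n \<omega>') x \<partial>M') = h (Y (Suc n)) x"
      and hatbar: "(\<integral>\<omega>'. transpose (Dmub (t n) (Xh n \<omega>') (\<mu> n) (uh n \<omega>') x) *v Ybarh (Suc n) \<omega>'
                       + Dmuf (t n) (Xh n \<omega>') (\<mu> n) (uh n \<omega>') x \<partial>M') = h (Ybar (Suc n)) x" for x
      using copy_of_family_integral_eq[OF copy(1) n uU' copy(2)[OF nN(1)] continuous_on_mean_field_integrand[OF contA contD, of x]]
      by (simp_all only: h_def A_def D_def prod.case)
    have hbar: "h (Ybar (Suc n)) x = h (Y (Suc n)) x" for x
      using fun_cong[OF mean_field(1), of x] by (simp only: h_def)
    \<comment> \<open>By \<open>hbar\<close> this single random variable is the mean-field term of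
      both recursions.\<close>
    define H where "H = (\<lambda>\<omega>. h (Y (Suc n)) (X n \<omega>))"
    have HF: "H \<in> borel_measurable (F (t n))"
      unfolding H_def by (rule measurable_compose[OF XF[OF nN(1)] mean_field(2)])
    have H_mod: "moderate M H"
    proof -
      obtain c k where "\<And>x. norm (h (Y (Suc n)) x) \<le> c + k * norm x" using mean_field(3) by blast
      then have "H \<in> L2 M"
        by (intro L2_linear_growth[OF measurable_from_subalg[OF filt(2) HF] XL[OF nN(1)] L2_const[of "0 :: real"], of c k])
          (auto simp: H_def)
      then show ?thesis by (rule moderate_L2)
    qed

    \<comment> \<open>Coefficients of the affine map in \<open>backward_step\<close>: gradient of
      \<open>f\<close>, and directional derivatives of drift and diffusion. The last two are bounded
      by assumption; the gradient of \<open>f\<close> has linear growth and is thus square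
      integrable.\<close>
    define a where "a = (\<lambda>\<omega>. \<Sum>i\<in>Basis. blinfun_apply (Dxf (t n) (X n \<omega>) (\<mu> n) (u n \<omega>)) i *\<^sub>R i)"
    define B where "B = (\<lambda>i \<omega>. blinfun_apply (Dxb (t n) (X n \<omega>) (\<mu> n) (u n \<omega>)) i)"
    define S where "S = (\<lambda>i \<omega>. blinfun_apply (Dxs (t n) (X n \<omega>) (u n \<omega>)) i)"
    have grad_eq: "grad_x_hamiltonian b \<sigma> f (t n) (X n \<omega>) (\<mu> n) v w (u n \<omega>)
        = a \<omega> + (\<Sum>i\<in>Basis. (B i \<omega> \<bullet> v + S i \<omega> \<bullet> w) *\<^sub>R i)" if "\<omega> \<in> space M" for \<omega> v w
      unfolding a_def B_def S_def
      using uU'[OF that]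
      by (intro grad_x_hamiltonian_eq C1_in_xu_has_derivative[OF Dxf(1) \<mu>n] C1_in_xu_has_derivative[OF Dxb(1) \<mu>n]
          C1_in_xu_has_derivative[OF Dxs(1) \<mu>n])
    have meas_xu: "(\<lambda>\<omega>. blinfun_apply (k (X n \<omega>) (u n \<omega>)) i) \<in> borel_measurable (F (t n))"
      if k: "continuous_on (UNIV \<times> U) (\<lambda>(x, a). k x a)" for k :: "real^'d \<Rightarrow> real^'c \<Rightarrow> (real^'d) \<Rightarrow>\<^sub>L 'e::euclidean_space" and i
    proof -
      have "continuous_on (UNIV \<times> U) (\<lambda>(x, a). blinfun_apply (k x a) i)"
        using bounded_linear.continuous_on[OF blinfun.bounded_linear_left k] by (simp add: case_prod_unfold)
      from measurable_compose_continuous_on[OF this borel_measurable_Pair[OF XF[OF nN(1)] uFb[OF nN(1)]]]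
      show ?thesis using uU' by (simp add: space_F)
    qed
    have BF: "B i \<in> borel_measurable (F (t n))" for i
      unfolding B_def using Dxb(1)
      by (intro meas_xu continuous_on_slice_xu[OF _ \<mu>n]) (auto simp: C1_in_xu_def)
    have SF: "S i \<in> borel_measurable (F (t n))" for i
      unfolding S_def using Dxs(1)
      by (intro meas_xu continuous_on_slice_xu[where D = "\<lambda>x _ a. Dxs (t n) x a", OF _ \<mu>n]) (auto simp: C1_in_xu_def)
    have aF: "a \<in> borel_measurable (F (t n))"
      unfolding a_def using Dxf(1)
      by (intro borel_measurable_sum borel_measurable_scaleR borel_measurable_const meas_xu continuous_on_slice_xu[OF _ \<mu>n])
        (auto simp: C1_in_xu_def)
    \<comment> \<open>The backward step works with one bound for both families, hence the
      maximum.\<close>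
    have B_le: "norm (B i \<omega>) \<le> max Cb Cs" if "i \<in> Basis" "\<omega> \<in> space M" for i \<omega>
      unfolding B_def using norm_blinfun[of "Dxb (t n) (X n \<omega>) (\<mu> n) (u n \<omega>)" i] Dxb(2)[OF uU'[OF that(2)], of "X n \<omega>"] that(1)
      by simp
    have S_le: "norm (S i \<omega>) \<le> max Cb Cs" if "i \<in> Basis" "\<omega> \<in> space M" for i \<omega>
      unfolding S_def using norm_blinfun[of "Dxs (t n) (X n \<omega>) (u n \<omega>)" i] Dxs(2)[OF uU'[OF that(2)], of "X n \<omega>"] that(1)
      by simp
    have a_mod: "moderate M a"
    proof (rule moderate_L2)
      let ?d = "real DIM(real^'d)"
      define s where "s = \<bar>sqrt (second_moment (\<mu> n))\<bar>"
      show "a \<in> L2 M"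
      proof (rule L2_linear_growth[OF measurable_from_subalg[OF filt(2) aF] XL[OF nN(1)] admissible(1)[OF n]])
        show "AE \<omega> in M. norm (a \<omega>) \<le> ?d * \<bar>Cf\<bar> * (1 + s) + ?d * \<bar>Cf\<bar> * (norm (X n \<omega>) + norm (u n \<omega>))"
        proof (intro AE_I2)
          fix \<omega> assume \<omega>: "\<omega> \<in> space M"
          have "norm (a \<omega>) \<le> ?d * norm (Dxf (t n) (X n \<omega>) (\<mu> n) (u n \<omega>))"
            unfolding a_def by (rule norm_sum_blinfun_Basis_le)
          also have "\<dots> \<le> ?d * (\<bar>Cf\<bar> * (1 + norm (X n \<omega>) + norm (u n \<omega>) + s))"
          proof (intro mult_left_mono)
            have "norm (Dxf (t n) (X n \<omega>) (\<mu> n) (u n \<omega>)) \<le> \<bar>Cf * (1 + norm (X n \<omega>) + norm (u n \<omega>) + sqrt (second_moment (\<mu> n)))\<bar>"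
              using Dxf(2)[OF uU'[OF \<omega>], of "X n \<omega>"] by linarith
            also have "\<dots> \<le> \<bar>Cf\<bar> * (1 + norm (X n \<omega>) + norm (u n \<omega>) + s)"
              unfolding abs_mult s_def using norm_ge_zero[of "X n \<omega>"] norm_ge_zero[of "u n \<omega>"]
              by (intro mult_left_mono abs_ge_zero) linarith
            finally show "norm (Dxf (t n) (X n \<omega>) (\<mu> n) (u n \<omega>)) \<le> \<bar>Cf\<bar> * (1 + norm (X n \<omega>) + norm (u n \<omega>) + s)" .
          qed simp
          also have "\<dots> = ?d * \<bar>Cf\<bar> * (1 + s) + ?d * \<bar>Cf\<bar> * (norm (X n \<omega>) + norm (u n \<omega>))"
            by (simp add: algebra_simps)
          finally show "norm (a \<omega>) \<le> ?d * \<bar>Cf\<bar> * (1 + s) + ?d * \<bar>Cf\<bar> * (norm (X n \<omega>) + norm (u n \<omega>))" .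
        qed
      qed
    qed

    let ?A = "\<lambda>v w \<omega>. v \<omega> + dt *\<^sub>R (a \<omega> + (\<Sum>i\<in>Basis. (B i \<omega> \<bullet> v \<omega> + S i \<omega> \<bullet> w \<omega>) *\<^sub>R i))"
    let ?G = "\<lambda>v w \<omega>. v \<omega> + dt *\<^sub>R grad_x_hamiltonian b \<sigma> f (t n) (X n \<omega>) (\<mu> n) (v \<omega>) (w \<omega>) (u n \<omega>)"
    have Yn': "AE \<omega> in M. Y n \<omega> = cond_expectation M (F (t n)) (?A (Y (Suc n)) (Z n)) \<omega> + dt *\<^sub>R H \<omega>"
    proof -
      have [measurable]: "Y (Suc n) \<in> borel_measurable M" "Z n \<in> borel_measurable M" "a \<in> borel_measurable M"
        "B i \<in> borel_measurable M" "S i \<in> borel_measurable M" for i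
        using Y_meas Z_meas nN n aF BF SF measurable_from_subalg[OF filt(2)] by blast+
      have A_meas: "?A (Y (Suc n)) (Z n) \<in> borel_measurable M" by measurable
      have GA: "?G (Y (Suc n)) (Z n) \<omega> = ?A (Y (Suc n)) (Z n) \<omega>" if "\<omega> \<in> space M" for \<omega>
        by (simp add: grad_eq[OF that])
      \<comment> \<open>The gradient formula holds on \<open>space M\<close> only, so the integrand
        is replaced by an almost everywhere congruence instead of rewriting under the conditional
        expectation.\<close>
      have "AE \<omega> in M. cond_expectation M (F (t n)) (?G (Y (Suc n)) (Z n)) \<omega> = cond_expectation M (F (t n)) (?A (Y (Suc n)) (Z n)) \<omega>"
      proof (rule G.cond_expectation_cong_AE[OF AE_I2[OF GA] _ A_meas])
        show "?G (Y (Suc n)) (Z n) \<in> borel_measurable M"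
          using measurable_cong[of M "?G (Y (Suc n)) (Z n)" "?A (Y (Suc n)) (Z n)" borel, OF GA] A_meas by blast
      qed
      then show ?thesis using Y_n[OF n] unfolding hat H_def by eventually_elim simp
    qed
    have Ybarn': "AE \<omega> in M. Ybar n \<omega> = ?A (Ybar (Suc n)) (Zbar n) \<omega> + dt *\<^sub>R H \<omega>"
      using Ybar_n[OF n] AE_space unfolding hatbar hbar H_def
      by eventually_elim (simp add: grad_eq)
    have bs: "moderate M (Z n)" "moderate M (Zbar n)" "moderate M (Y n)" "moderate M (Ybar n)"
      "AE \<omega> in M. cond_expectation M (F (t n)) (Zbar n) \<omega> = Z n \<omega>"
      "AE \<omega> in M. cond_expectation M (F (t n)) (Ybar n) \<omega> = Y n \<omega>"
      by (rule backward_step[OF fin filt(2) sub y ybar eq dW_meas[OF n] dW_mom[OF n] a_mod aF H_mod HF BF B_le SF S_le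
        Y_meas[OF nN(1)] Ybar_meas[OF nN(1)] Z_meas[OF n] Zbar_meas[OF n] Z_n[OF n] Zbar_n[OF n] Yn' Ybarn']; assumption)+
    \<comment> \<open>\<open>F (t n)\<close> need not contain the null sets, so \<open>Y n\<close>
      is \<open>F (t n)\<close>-measurable only up to a version. Its invariance follows from
      idempotence of the conditional expectation applied to \<open>Ybar n\<close>.\<close>
    have "AE \<omega> in M. cond_expectation M (F (t n)) (Y n) \<omega> = Y n \<omega>"
    proof -
      have "AE \<omega> in M. cond_expectation M (F (t n)) (cond_expectation M (F (t n)) (Ybar n)) \<omega> = cond_expectation M (F (t n)) (Ybar n) \<omega>"
        by (intro G.cond_expectation_F_meas G.integrable_cond_expectation moderate_integrable bs) measurable
      moreover have "AE \<omega> in M. cond_expectation M (F (t n)) (cond_expectation M (F (t n)) (Ybar n)) \<omega> = cond_expectation M (F (t n)) (Y n) \<omega>"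
        by (rule G.cond_expectation_cong_AE[OF bs(6)]) (use Y_meas[OF nN(1)] in measurable)
      ultimately show ?thesis using bs(6) by eventually_elim simp
    qed
    then have "AE \<omega> in M. cond_expectation M (F (t n)) (Ybar n) \<omega> = cond_expectation M (F (t n)) (Y n) \<omega>"
      using bs(6) by eventually_elim simp
    then show ?thesis using bs by (simp add: good_def)
  qed

  \<comment> \<open>Backward induction and full expectations\<close>
  have "good N"
  proof -
    interpret G: finite_measure_subalgebra M "F (t N)" by unfold_locales (rule filt(2))
    have "AE \<omega> in M. Ybar N \<omega> = Y N \<omega>" using Y_N Ybar_N by eventually_elim simp
    from G.cond_expectation_cong_AE[OF this Ybar_meas[OF order_refl] Y_meas[OF order_refl]]
    show ?thesis
      unfolding good_def using terminal[OF Y_meas[OF order_refl] Y_N] terminal[OF Ybar_meas[OF order_refl] Ybar_N] by blast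
  qed
  have good: "good n" if "n \<le> N" for n
    using that
  proof (induction n rule: inc_induct)
    case base
    show ?case by fact
  next
    case (step m)
    then show ?case using backward by blast
  qed
  show ?thesis
  proof (intro allI impI)
    fix n assume n: "n < N"
    interpret G: finite_measure_subalgebra M "F (t n)" by unfold_locales (rule filt(2))
    have g: "good n" and Z: "moderate M (Z n)" "moderate M (Zbar n)"
      and EY: "AE \<omega> in M. cond_expectation M (F (t n)) (Ybar n) \<omega> = Y n \<omega>"
      and EZ: "AE \<omega> in M. cond_expectation M (F (t n)) (Zbar n) \<omega> = Z n \<omega>"
      using backward[OF n good] n by auto
    have int: "integrable M (Ybar n)" "integrable M (Zbar n)" "integrable M (Y n)" "integrable M (Z n)"
      using g Z moderate_integrable by (auto simp: good_def)
    have "(\<integral>\<omega>. Ybar n \<omega> \<partial>M) = (\<integral>\<omega>. Y n \<omega> \<partial>M)"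
      unfolding G.integral_cond_expectation[OF int(1), symmetric] using EY int(3)
      by (intro integral_cong_AE) auto
    moreover have "(\<integral>\<omega>. Zbar n \<omega> \<partial>M) = (\<integral>\<omega>. Z n \<omega> \<partial>M)"
      unfolding G.integral_cond_expectation[OF int(2), symmetric] using EZ int(4)
      by (intro integral_cong_AE) auto
    ultimately show "integrable M (Ybar n) \<and> integrable M (Zbar n) \<and> integrable M (Y n) \<and> integrable M (Z n) \<and>
      (AE \<omega> in M. cond_expectation M (F (t n)) (Ybar n) \<omega> = Y n \<omega>) \<and>
      (AE \<omega> in M. cond_expectation M (F (t n)) (Zbar n) \<omega> = Z n \<omega>) \<and>
      (\<integral>\<omega>. Ybar n \<omega> \<partial>M) = (\<integral>\<omega>. Y n \<omega> \<partial>M) \<and>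
      (\<integral>\<omega>. Zbar n \<omega> \<partial>M) = (\<integral>\<omega>. Z n \<omega> \<partial>M)"
      using int EY EZ by blast
  qed
qed

end
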